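(* Consider a sequence of regression models $\mathbf{y}=X_p\boldsymbol{\beta}_p+\boldsymbol{\epsilon}$ with nearly-orthogonal design under structural constraints, with $r=\mathrm{rank}(X_p)\to\infty$, and let $\ln m(k)=O(k)$, $k=1,\ldots,r-1$ (uniformly in $k$ and along the sequence). As $r$ increases: 1. $$\inf_{\tilde{\mathbf{y}}}\sup_{\boldsymbol{\beta}_M:\,M\in\mathfrak{M}_{p_0}}E\|\tilde{\mathbf{y}}-X_p\boldsymbol{\beta}_M\|^2\asymp\sigma^2p_0$$ for all $p_0=1,\ldots,r$, where the infimum is over all estimators $\tilde{\mathbf{y}}$ of the mean vector. 2. Let $\gamma>0$ and $c(\gamma)=8(\gamma+3/4)^2$, and assume that for some constant $c>0$, $e^{-ck}\le\pi(k)\le m(k)e^{-c(\gamma)k}$ for all $k=1,\ldots,r$ with $m(k)>0$. Then the resulting MAP estimator $X_p\hat{\boldsymbol{\beta}}_{\hat M}$ attains the minimax rates simultaneously over all $\mathfrak{M}_{p_0}$, $1\le p_0\le r$; that is, there is a constant $C>0$ such that for all sufficiently large $r$ and all $1\le p_0\le r$, $$\sup_{\boldsymbol{\beta}_M:\,M\in\mathfrak{M}_{p_0}}E\|X_p\hat{\boldsymbol{\beta}}_{\hat M}-X_p\boldsymbol{\beta}_M\|^2\le C\inf_{\tilde{\mathbf{y}}}\sup_{\boldsymbol{\beta}_M:\,M\in\mathfrak{M}_{p_0}}E\|\tilde{\mathbf{y}}-X_p\boldsymbol{\beta}_M\|^2.$$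
   Context: Asymptotic setup: a sequence indexed by the sample size $n$ of models $\mathbf{y}=X_p\boldsymbol{\beta}_p+\boldsymbol{\epsilon}$, where $p=p_n$ may grow with $n$ (possibly $p>n$), $X_p\in\mathbb{R}^{n\times p}$ with columns (predictors) $X_1,\ldots,X_p$, $\boldsymbol{\epsilon}\sim N(\mathbf{0},\sigma^2I_n)$, with $\sigma^2>0$ known and not depending on $n,p$; $r=r_n=\mathrm{rank}(X_p)\to\infty$, and any $r$ columns of $X_p$ are linearly independent. The index $n$ is suppressed; the admissible models, the $m(k)$ and the priors $\pi$ also depend on $n$, while $\gamma$ and $c$ do not. The relation $a\asymp b$ means that $C_1b\le a\le C_2b$ for all sufficiently large $r$ with constants $0<C_1\le C_2<\infty$ not depending on $n$, $p$, $r$, $p_0$. A model $M$ is a subset of the predictors, encoded by $D_M=\mathrm{diag}(\mathbf{d}_M)$, $d_{Mj}=1$ if $X_j\in M$ and $0$ otherwise; its size is $|M|=\mathrm{tr}(D_M)$. The least squares estimator for $M$ is $\hat{\boldsymbol{\beta}}_M=(D_MX_p'X_pD_M)^+D_MX_p'\mathbf{y}$. Structural constraints: a fixed known set of admissible models, restricted to sizes at most $r$. $\mathcal{M}_k$ is the set of admissible models of size $k$, $m(k)=\mathrm{card}(\mathcal{M}_k)\le\binom{p}{k}$. The null model is admissible, so $m(0)=1$. All models of size $r$ are identified with a single saturated model, represented by a fixed set of $r$ columns, so $m(r)=1$. $\mathfrak{M}_{p_0}=\bigcup_{k=0}^{p_0}\mathcal{M}_k$. For a model $M$, $\boldsymbol{\beta}_M\in\mathbb{R}^p$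 denotes a coefficient vector with $\beta_{Mj}\neq0$ iff $X_j\in M$; suprema are over all such vectors with $M\in\mathfrak{M}_{p_0}$, and expectations are under $\mathbf{y}=X_p\boldsymbol{\beta}_M+\boldsymbol{\epsilon}$. The prior $\pi(k)$, $k=0,\ldots,r$, is a probability distribution on model sizes with $\pi(k)=0$ iff $m(k)=0$. The MAP model $\hat M$ is a minimizer over admissible $M$ of $$\|\mathbf{y}-X_p\hat{\boldsymbol{\beta}}_M\|^2+2\sigma^2(1+1/\gamma)\ln\left\{m(|M|)\pi(|M|)^{-1}(1+\gamma)^{|M|/2}\right\}.$$ Sparse eigenvalue ratios: $\tau_p[k]=\phi_{min}[k]/\phi_{max}[k]$, where $\phi_{min}[k]$ and $\phi_{max}[k]$ are the minimum and maximum of $\|X_p\boldsymbol{\beta}\|^2/\|\boldsymbol{\beta}\|^2$ over $\boldsymbol{\beta}$ with between $1$ and $k$ nonzero entries. The design is nearly-orthogonal if the sequence $\tau_p[r]$ is bounded away from zero. *)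

theory Defs
  imports "HOL-Probability.Probability" "Jordan_Normal_Form.DL_Rank"
begin

section \<open>Vectors and matrices\<close>

definition sqnorm :: "real Matrix.vec \<Rightarrow> real" where
  "sqnorm v = scalar_prod v v"

definition supp :: "real Matrix.vec \<Rightarrow> nat set" where
  "supp v = {j. j < dim_vec v \<and> vec_index v j \<noteq> 0}"

definition is_moore_penrose :: "real mat \<Rightarrow> real mat \<Rightarrow> bool" where
  "is_moore_penrose A B \<longleftrightarrow>
     B \<in> carrier_mat (dim_col A) (dim_row A) \<and>
     A * B * A = A \<and> B * A * B = B \<and>
     transpose_mat (A * B) = A * B \<and> transpose_mat (B * A) = B * A"

definition pinv :: "real mat \<Rightarrow> real mat" where
  "pinv A = (THE B. is_moore_penrose A B)"

text \<open>Equal columns at different positions count as dependent; the set of columns alone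
  would not see this, hence the injectivity.\<close>

definition every_cols_indep :: "nat \<Rightarrow> real mat \<Rightarrow> bool" where
  "every_cols_indep k X \<longleftrightarrow>
     (\<forall>J \<subseteq> {..<dim_col X}. card J = k \<longrightarrow>
        inj_on (col X) J \<and>
        \<not> module.lin_dep class_ring (module_vec TYPE(real) (dim_row X)) (col X ` J))"

text \<open>The ranges below are compact for \<open>1 \<le> k\<close> and \<open>1 \<le> dim_col X\<close>, so the infimum and
  the supremum are then the minimum and the maximum.\<close>

definition sparse_quotients :: "real mat \<Rightarrow> nat \<Rightarrow> real set" where
  "sparse_quotients X k =
     (\<lambda>b. sqnorm (X *\<^sub>v b) / sqnorm b) ` {b \<in> carrier_vec (dim_col X). card (supp b) \<in> {1..k}}"

definition phi_min :: "real mat \<Rightarrow> nat \<Rightarrow> real" where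
  "phi_min X k = Inf (sparse_quotients X k)"

definition phi_max :: "real mat \<Rightarrow> nat \<Rightarrow> real" where
  "phi_max X k = Sup (sparse_quotients X k)"

definition tau :: "real mat \<Rightarrow> nat \<Rightarrow> real" where
  "tau X k = phi_min X k / phi_max X k"


section \<open>Models\<close>

text \<open>Predictors are numbered from 0; a model is the set of the indices of its predictors.\<close>

definition models_of_size :: "nat set set \<Rightarrow> nat \<Rightarrow> nat set set" where
  "models_of_size A k = {M \<in> A. card M = k}"

definition num_models :: "nat set set \<Rightarrow> nat \<Rightarrow> nat" where
  "num_models A k = card (models_of_size A k)"

text \<open>Sizes without admissible models are allowed. If no model of size between 1 and \<open>k\<close> is
  admissible, the class below is that of the null model alone, with minimax risk 0.\<close>

definition models_upto :: "nat set set \<Rightarrow> nat \<Rightarrow> nat set set" where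
  "models_upto A k = (\<Union>i\<le>k. models_of_size A i)"

text \<open>The only admissible model of size \<open>r\<close> is the saturated one.\<close>

definition admissible_class :: "nat \<Rightarrow> nat \<Rightarrow> nat set set \<Rightarrow> bool" where
  "admissible_class p r A \<longleftrightarrow>
     (\<forall>M\<in>A. M \<subseteq> {..<p} \<and> card M \<le> r) \<and> {} \<in> A \<and> num_models A r = 1"

definition coeffs :: "nat \<Rightarrow> nat set set \<Rightarrow> real Matrix.vec set" where
  "coeffs p Ms = {b \<in> carrier_vec p. supp b \<in> Ms}"

definition ls_est :: "real mat \<Rightarrow> nat set \<Rightarrow> real Matrix.vec \<Rightarrow> real Matrix.vec" where
  "ls_est X M y =
     (let D = mat_diag (dim_col X) (\<lambda>j. if j \<in> M then 1 else 0)
      in (pinv (D * transpose_mat X * X * D) * D * transpose_mat X) *\<^sub>v y)"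


section \<open>Gaussian noise, estimators and risk\<close>

text \<open>The Borel sigma-algebra on the vectors of dimension \<open>n\<close>.\<close>

definition vec_borel :: "nat \<Rightarrow> real Matrix.vec measure" where
  "vec_borel n =
     vimage_algebra (carrier_vec n) (\<lambda>v. \<lambda>i\<in>{..<n}. vec_index v i) (\<Pi>\<^sub>M i\<in>{..<n}. borel)"

definition gauss_noise :: "nat \<Rightarrow> real \<Rightarrow> real Matrix.vec measure" where
  "gauss_noise n \<sigma> =
     distr (\<Pi>\<^sub>M i\<in>{..<n}. density lborel (normal_density 0 \<sigma>)) (vec_borel n) (Matrix.vec n)"

definition estimators :: "nat \<Rightarrow> (real Matrix.vec \<Rightarrow> real Matrix.vec) set" where
  "estimators n = measurable (vec_borel n) (vec_borel n)"

text \<open>Risks are extended nonnegative reals: the loss of an arbitrary estimator need not be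
  integrable.\<close>

definition risk ::
  "real \<Rightarrow> real mat \<Rightarrow> (real Matrix.vec \<Rightarrow> real Matrix.vec) \<Rightarrow> real Matrix.vec \<Rightarrow> ennreal" where
  "risk \<sigma> X t b =
     (\<integral>\<^sup>+ e. ennreal (sqnorm (t (X *\<^sub>v b + e) - X *\<^sub>v b)) \<partial>gauss_noise (dim_row X) \<sigma>)"

definition max_risk ::
  "real \<Rightarrow> real mat \<Rightarrow> nat set set \<Rightarrow> (real Matrix.vec \<Rightarrow> real Matrix.vec) \<Rightarrow> ennreal" where
  "max_risk \<sigma> X Ms t = (SUP b\<in>coeffs (dim_col X) Ms. risk \<sigma> X t b)"

definition minimax_risk :: "real \<Rightarrow> real mat \<Rightarrow> nat set set \<Rightarrow> ennreal" where
  "minimax_risk \<sigma> X Ms = (INF t\<in>estimators (dim_row X). max_risk \<sigma> X Ms t)"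


section \<open>MAP model selection\<close>

definition size_prior :: "nat \<Rightarrow> nat set set \<Rightarrow> nat pmf \<Rightarrow> bool" where
  "size_prior r A \<pi> \<longleftrightarrow>
     set_pmf \<pi> \<subseteq> {0..r} \<and> (\<forall>k\<in>{0..r}. pmf \<pi> k = 0 \<longleftrightarrow> num_models A k = 0)"

definition map_crit ::
  "real \<Rightarrow> real \<Rightarrow> real mat \<Rightarrow> nat set set \<Rightarrow> nat pmf \<Rightarrow> real Matrix.vec \<Rightarrow> nat set \<Rightarrow> real" where
  "map_crit \<sigma> \<gamma> X A \<pi> y M =
     sqnorm (y - X *\<^sub>v ls_est X M y) +
     2 * \<sigma>\<^sup>2 * (1 + 1 / \<gamma>) *
       ln (real (num_models A (card M)) * inverse (pmf \<pi> (card M)) * (1 + \<gamma>) powr (real (card M) / 2))"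

text \<open>Minimizers need not be unique; any measurable choice of one is a MAP model.\<close>

definition is_map_model ::
  "real \<Rightarrow> real \<Rightarrow> real mat \<Rightarrow> nat set set \<Rightarrow> nat pmf \<Rightarrow> (real Matrix.vec \<Rightarrow> nat set) \<Rightarrow> bool" where
  "is_map_model \<sigma> \<gamma> X A \<pi> Mhat \<longleftrightarrow>
     Mhat \<in> measurable (vec_borel (dim_row X)) (count_space A) \<and>
     (\<forall>y\<in>carrier_vec (dim_row X). is_arg_min (map_crit \<sigma> \<gamma> X A \<pi> y) (\<lambda>M. M \<in> A) (Mhat y))"

definition map_est ::
  "real mat \<Rightarrow> (real Matrix.vec \<Rightarrow> nat set) \<Rightarrow> real Matrix.vec \<Rightarrow> real Matrix.vec" where
  "map_est X Mhat y = X *\<^sub>v ls_est X (Mhat y) y"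

end

theory Submission
  imports Defs
begin

text \<open>
  Positivity of the sparse eigenvalue ratio makes the columns of every admissible model
  linearly independent, so that \<open>X *\<^sub>v ls_est X M y\<close> is the orthogonal projection of the data
  to a space of dimension \<open>card M\<close>. The rest of the argument is about projections of
  Gaussian vectors and numbers of models. All bounds hold for each single design with constants that depend on \<open>\<gamma>\<close>, \<open>c\<close> and
  the growth rate \<open>K\<close> of the model counts alone.

  The lower bound uses a single admissible model of the largest size. Along an orthonormal frame of
  its space the mean vector is moved by \<open>\<plusminus>\<sigma> / 2\<close> in each direction. Two neighbours in this cube
  cannot be told apart reliably, so every estimator loses a multiple of \<open>\<sigma>\<^sup>2\<close> per
  direction (\<open>two_point_lower_bound\<close>, \<open>max_risk_lower_bound\<close>).

  The upper bounds come from one oracle inequality for penalized least squares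
  (\<open>map_est_risk_le\<close>). The loss of the selected model \<open>M\<close> is, up to a constant factor, at
  most the penalty of any model \<open>M0\<close> containing the true one, plus the squared length of the noise
  projected to the span of \<open>M\<close> and \<open>M0\<close>, minus the penalty of \<open>M\<close>. The
  projected noise has an explicit moment generating function
  (\<open>gauss_noise_chi_square_mgf\<close>), so a union bound over all models works whenever the
  exponentials of the negative penalties are summable against it.

  A penalty proportional to the model size satisfies this because \<open>ln m(k) = O(k)\<close>, which
  bounds the minimax risk from above. The penalty of the MAP criterion satisfies it because,
  exponentiated with the right constant, it gives back the prior probabilities of the models, which
  sum to at most one; the upper bound imposed on the prior leaves the slack needed to make
  the constant factor in front of the loss finite (\<open>map_risk_upper_bound\<close>). The lower bound on
  the prior and the bound on the number of models keep the penalty of a model of size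
  \<open>k\<close> of order \<open>\<sigma>\<^sup>2 * k\<close>, so that the upper bounds match the lower bound.
\<close>

unbundle no inner_syntax and no vec_syntax


section \<open>Gaussian noise vectors\<close>

lemma mult_mat_vec_carrier_iff [simp]: "A *\<^sub>v v \<in> carrier_vec n \<longleftrightarrow> dim_row A = n"
  by (metis carrier_vecD carrier_vecI dim_mult_mat_vec)

lemma space_vec_borel [simp]: "space (vec_borel n) = carrier_vec n"
  by (simp add: vec_borel_def)

lemma measurable_vec_index [measurable]:
  assumes "i < n"
  shows "(\<lambda>v. v $ i) \<in> borel_measurable (vec_borel n)"
proof -
  have "(\<lambda>v. \<lambda>i\<in>{..<n}. v $ i) \<in> measurable (vec_borel n) (\<Pi>\<^sub>M i\<in>{..<n}. (borel :: real measure))"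
    unfolding vec_borel_def
    by (rule measurable_vimage_algebra1) (auto simp: space_PiM)
  from measurable_compose[OF this measurable_component_singleton[of i "{..<n}"]] assms
  show ?thesis by simp
qed

text \<open>As the sigma-algebra is the initial one for the coordinates, measurability into it can be
  checked coordinatewise.\<close>

lemma measurable_vec_borelI:
  assumes "\<And>x. x \<in> space M \<Longrightarrow> f x \<in> carrier_vec n"
    and "\<And>i. i < n \<Longrightarrow> (\<lambda>x. f x $ i) \<in> borel_measurable M"
  shows "f \<in> measurable M (vec_borel n)"
  unfolding vec_borel_def using assms
  by (intro measurable_vimage_algebra2 measurable_restrict) auto

lemma measurable_scalar_prod [measurable]:
  fixes f g :: "'a \<Rightarrow> real Matrix.vec"
  assumes "f \<in> measurable M (vec_borel n)" "g \<in> measurable M (vec_borel n)"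
  shows "(\<lambda>x. f x \<bullet> g x) \<in> borel_measurable M"
proof -
  have "(\<lambda>x. \<Sum>i\<in>{0..<n}. f x $ i * g x $ i) \<in> borel_measurable M"
    using measurable_compose[OF assms(1) measurable_vec_index]
      measurable_compose[OF assms(2) measurable_vec_index]
    by (intro borel_measurable_sum borel_measurable_times) auto
  moreover have "(\<Sum>i\<in>{0..<n}. f x $ i * g x $ i) = f x \<bullet> g x" if "x \<in> space M" for x
    using measurable_space[OF assms(2) that] by (simp add: scalar_prod_def)
  ultimately show ?thesis by (simp cong: measurable_cong)
qed

lemma measurable_sqnorm [measurable]:
  assumes "f \<in> measurable M (vec_borel n)"
  shows "(\<lambda>x. sqnorm (f x)) \<in> borel_measurable M"
  unfolding sqnorm_def using assms by measurable

lemma measurable_vec_plus: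
  assumes "f \<in> measurable M (vec_borel n)" "g \<in> measurable M (vec_borel n)"
  shows "(\<lambda>x. f x + g x) \<in> measurable M (vec_borel n)"
proof (rule measurable_vec_borelI)
  fix i assume i: "i < n"
  have "(\<lambda>x. f x $ i + g x $ i) \<in> borel_measurable M"
    using measurable_compose[OF assms(1) measurable_vec_index[OF i]]
      measurable_compose[OF assms(2) measurable_vec_index[OF i]]
    by (rule borel_measurable_add)
  moreover have "(f x + g x) $ i = f x $ i + g x $ i" if "x \<in> space M" for x
    using measurable_space[OF assms(2) that] i by simp
  ultimately show "(\<lambda>x. (f x + g x) $ i) \<in> borel_measurable M"
    by (simp cong: measurable_cong)
qed (use measurable_space[OF assms(1)] measurable_space[OF assms(2)] in auto)

lemma measurable_vec_minus:
  assumes "f \<in> measurable M (vec_borel n)" "g \<in> measurable M (vec_borel n)"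
  shows "(\<lambda>x. f x - g x) \<in> measurable M (vec_borel n)"
proof (rule measurable_vec_borelI)
  fix i assume i: "i < n"
  have "(\<lambda>x. f x $ i - g x $ i) \<in> borel_measurable M"
    using measurable_compose[OF assms(1) measurable_vec_index[OF i]]
      measurable_compose[OF assms(2) measurable_vec_index[OF i]]
    by (rule borel_measurable_diff)
  moreover have "(f x - g x) $ i = f x $ i - g x $ i" if "x \<in> space M" for x
    using measurable_space[OF assms(2) that] i by simp
  ultimately show "(\<lambda>x. (f x - g x) $ i) \<in> borel_measurable M"
    by (simp cong: measurable_cong)
qed (use measurable_space[OF assms(1)] measurable_space[OF assms(2)] in auto)

lemma measurable_mult_mat_vec:
  assumes Q: "Q \<in> carrier_mat m n" and f: "f \<in> measurable M (vec_borel n)"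
  shows "(\<lambda>x. Q *\<^sub>v f x) \<in> measurable M (vec_borel m)"
proof (rule measurable_vec_borelI)
  fix i assume i: "i < m"
  have "(\<lambda>x. row Q i \<bullet> f x) \<in> borel_measurable M"
    using i Q by (intro measurable_scalar_prod[OF _ f] measurable_const) auto
  then show "(\<lambda>x. (Q *\<^sub>v f x) $ i) \<in> borel_measurable M"
    using i Q by simp
qed (rule carrier_vecI, use Q in simp)

lemma measurable_vec_of_coords:
  "Matrix.vec n \<in> measurable (\<Pi>\<^sub>M i\<in>{..<n}. density lborel (normal_density \<mu> \<sigma>)) (vec_borel n)"
  by (rule measurable_vec_borelI)
    (auto intro!: measurable_compose[OF measurable_component_singleton[of _ "{..<n}"]])

lemma sets_gauss_noise [measurable_cong, simp]: "sets (gauss_noise n \<sigma>) = sets (vec_borel n)"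
  by (simp add: gauss_noise_def)

lemma space_gauss_noise [simp]: "space (gauss_noise n \<sigma>) = carrier_vec n"
  by (simp add: gauss_noise_def)

lemma measurable_gauss_noise_eq [simp]:
  "measurable (gauss_noise n \<sigma>) N = measurable (vec_borel n) N"
  by (rule measurable_cong_sets) simp_all

lemma nn_integral_gauss_noise:
  assumes "f \<in> borel_measurable (vec_borel n)"
  shows "(\<integral>\<^sup>+ e. f e \<partial>gauss_noise n \<sigma>) =
    (\<integral>\<^sup>+ x. f (Matrix.vec n x) \<partial>(\<Pi>\<^sub>M i\<in>{..<n}. density lborel (normal_density 0 \<sigma>)))"
  unfolding gauss_noise_def using assms by (subst nn_integral_distr[OF measurable_vec_of_coords]) auto

lemma prob_space_gauss_noise:
  assumes "\<sigma> > 0"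
  shows "prob_space (gauss_noise n \<sigma>)"
  unfolding gauss_noise_def
  by (intro prob_space.prob_space_distr prob_space_PiM prob_space_normal_density assms
      measurable_vec_of_coords)

lemma product_sigma_finite_normal:
  assumes "\<sigma> > 0"
  shows "product_sigma_finite (\<lambda>i. density lborel (normal_density (m i) \<sigma>))"
proof -
  interpret prob_space "density lborel (normal_density (m i) \<sigma>)" for i
    using assms by (rule prob_space_normal_density)
  show ?thesis by unfold_locales
qed

lemma nn_integral_gauss_noise_prod:
  fixes f :: "nat \<Rightarrow> real \<Rightarrow> ennreal"
  assumes "\<sigma> > 0" and f: "\<And>i. i < n \<Longrightarrow> f i \<in> borel_measurable borel"
  shows "(\<integral>\<^sup>+ e. (\<Prod>i<n. f i (e $ i)) \<partial>gauss_noise n \<sigma>) =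
    (\<Prod>i<n. \<integral>\<^sup>+ x. f i x \<partial>density lborel (normal_density 0 \<sigma>))"
proof -
  interpret product_sigma_finite "\<lambda>i. density lborel (normal_density 0 \<sigma>)"
    using product_sigma_finite_normal[OF assms(1)] .
  have "(\<integral>\<^sup>+ e. (\<Prod>i<n. f i (e $ i)) \<partial>gauss_noise n \<sigma>) =
    (\<integral>\<^sup>+ x. (\<Prod>i<n. f i (x i)) \<partial>(\<Pi>\<^sub>M i\<in>{..<n}. density lborel (normal_density 0 \<sigma>)))"
    using f by (subst nn_integral_gauss_noise)
      (auto intro!: borel_measurable_prod_ennreal measurable_compose[OF measurable_vec_index f])
  also have "\<dots> = (\<Prod>i<n. \<integral>\<^sup>+ x. f i x \<partial>density lborel (normal_density 0 \<sigma>))"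
    using f by (intro product_nn_integral_prod) auto
  finally show ?thesis .
qed

text \<open>The exponential tilting behind both the moment generating function and the translation
  formula below.\<close>

lemma normal_density_shift:
  assumes "\<sigma> > 0"
  shows "normal_density 0 \<sigma> x * exp ((v * x - v\<^sup>2 / 2) / \<sigma>\<^sup>2) = normal_density v \<sigma> x"
  using assms by (simp add: normal_density_def mult_exp_exp field_simps power2_eq_square)

lemma nn_integral_normal_density [simp]:
  assumes "\<sigma> > 0"
  shows "(\<integral>\<^sup>+ x. ennreal (normal_density m \<sigma> x) \<partial>lborel) = 1"
  using assms by (simp add: nn_integral_eq_integral)

lemma nn_integral_exp_normal:
  assumes "\<sigma> > 0"
  shows "(\<integral>\<^sup>+ x. ennreal (exp (a * x)) \<partial>density lborel (normal_density 0 \<sigma>)) =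
    ennreal (exp (\<sigma>\<^sup>2 / 2 * a\<^sup>2))"
proof -
  have eq: "normal_density 0 \<sigma> x * exp (a * x) =
      exp (\<sigma>\<^sup>2 / 2 * a\<^sup>2) * normal_density (\<sigma>\<^sup>2 * a) \<sigma> x" for x
  proof -
    have "(\<sigma>\<^sup>2 * a * x - (\<sigma>\<^sup>2 * a)\<^sup>2 / 2) / \<sigma>\<^sup>2 + \<sigma>\<^sup>2 / 2 * a\<^sup>2 = a * x"
      using assms by (simp add: field_simps power2_eq_square)
    then have "exp (\<sigma>\<^sup>2 / 2 * a\<^sup>2) * exp ((\<sigma>\<^sup>2 * a * x - (\<sigma>\<^sup>2 * a)\<^sup>2 / 2) / \<sigma>\<^sup>2) = exp (a * x)"
      by (simp only: mult_exp_exp add.commute)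
    then show ?thesis
      unfolding normal_density_shift[OF assms, of x "\<sigma>\<^sup>2 * a", symmetric]
      by (simp only: mult.left_commute)
  qed
  have "(\<integral>\<^sup>+ x. ennreal (exp (a * x)) \<partial>density lborel (normal_density 0 \<sigma>)) =
    (\<integral>\<^sup>+ x. ennreal (exp (\<sigma>\<^sup>2 / 2 * a\<^sup>2)) * ennreal (normal_density (\<sigma>\<^sup>2 * a) \<sigma> x) \<partial>lborel)"
    by (subst nn_integral_density) (auto simp: ennreal_mult'[symmetric] eq)
  also have "\<dots> = ennreal (exp (\<sigma>\<^sup>2 / 2 * a\<^sup>2))"
    using assms by (subst nn_integral_cmult) auto
  finally show ?thesis .
qed

text \<open>Multiplying the standard normal density by \<open>exp (t / 2 * x\<^sup>2)\<close> gives, up to the factor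
  \<open>1 / sqrt (1 - t)\<close>, the normal density of variance \<open>1 / (1 - t)\<close>.\<close>

lemma nn_integral_exp_square_normal:
  assumes "0 \<le> t" "t < 1"
  shows "(\<integral>\<^sup>+ x. ennreal (exp (t / 2 * x\<^sup>2)) \<partial>density lborel std_normal_density) =
    ennreal (1 / sqrt (1 - t))"
proof -
  define s where "s = 1 / sqrt (1 - t)"
  have s: "s > 0" "s\<^sup>2 = 1 / (1 - t)" using assms by (auto simp: s_def power_divide)
  have eq: "std_normal_density x * exp (t / 2 * x\<^sup>2) = s * normal_density 0 s x" for x
  proof -
    have "s / sqrt (2 * pi * s\<^sup>2) = 1 / sqrt (2 * pi)"
    proof -
      have "sqrt (2 * pi * s\<^sup>2) = sqrt (2 * pi) * s"
        unfolding real_sqrt_mult using s(1) by simp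
      then show ?thesis using s(1) by simp
    qed
    moreover have "- x\<^sup>2 / 2 + t / 2 * x\<^sup>2 = - x\<^sup>2 / (2 * s\<^sup>2)"
      unfolding s(2) using assms by (simp add: field_simps)
    moreover have "s * normal_density 0 s x = s / sqrt (2 * pi * s\<^sup>2) * exp (- x\<^sup>2 / (2 * s\<^sup>2))"
      by (simp add: normal_density_def)
    ultimately have "s * normal_density 0 s x = 1 / sqrt (2 * pi) * exp (- x\<^sup>2 / 2 + t / 2 * x\<^sup>2)"
      by (simp only:)
    also have "\<dots> = std_normal_density x * exp (t / 2 * x\<^sup>2)"
      by (simp add: std_normal_density_def mult_exp_exp)
    finally show ?thesis ..
  qed
  have "(\<integral>\<^sup>+ x. ennreal (exp (t / 2 * x\<^sup>2)) \<partial>density lborel std_normal_density) =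
    (\<integral>\<^sup>+ x. ennreal (std_normal_density x) * ennreal (exp (t / 2 * x\<^sup>2)) \<partial>lborel)"
    by (rule nn_integral_density) auto
  also have "\<dots> = (\<integral>\<^sup>+ x. ennreal s * ennreal (normal_density 0 s x) \<partial>lborel)"
  proof (rule nn_integral_cong)
    fix x
    have "ennreal (std_normal_density x) * ennreal (exp (t / 2 * x\<^sup>2)) =
        ennreal (std_normal_density x * exp (t / 2 * x\<^sup>2))"
      by (rule ennreal_mult[symmetric]) auto
    also have "\<dots> = ennreal s * ennreal (normal_density 0 s x)"
      unfolding eq using s by (intro ennreal_mult) auto
    finally show "ennreal (std_normal_density x) * ennreal (exp (t / 2 * x\<^sup>2)) =
        ennreal s * ennreal (normal_density 0 s x)" .
  qed
  also have "\<dots> = ennreal s"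
    using s by (subst nn_integral_cmult) auto
  finally show ?thesis by (simp add: s_def)
qed

lemma scalar_prod_lessThan: "w \<in> carrier_vec n \<Longrightarrow> v \<bullet> w = (\<Sum>i<n. v $ i * w $ i)"
  by (auto simp: scalar_prod_def atLeast0LessThan)

lemma gauss_noise_mgf:
  assumes "\<sigma> > 0" "v \<in> carrier_vec n"
  shows "(\<integral>\<^sup>+ e. ennreal (exp (v \<bullet> e)) \<partial>gauss_noise n \<sigma>) = ennreal (exp (\<sigma>\<^sup>2 / 2 * sqnorm v))"
proof -
  have "(\<integral>\<^sup>+ e. ennreal (exp (v \<bullet> e)) \<partial>gauss_noise n \<sigma>) =
    (\<integral>\<^sup>+ e. (\<Prod>i<n. ennreal (exp (v $ i * e $ i))) \<partial>gauss_noise n \<sigma>)"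
    by (intro nn_integral_cong) (simp add: scalar_prod_lessThan exp_sum prod_ennreal)
  also have "\<dots> = (\<Prod>i<n. ennreal (exp (\<sigma>\<^sup>2 / 2 * (v $ i)\<^sup>2)))"
    using assms by (subst nn_integral_gauss_noise_prod) (auto simp: nn_integral_exp_normal)
  also have "\<dots> = ennreal (exp (\<sigma>\<^sup>2 / 2 * sqnorm v))"
    using assms by (simp add: prod_ennreal exp_sum[symmetric] sqnorm_def scalar_prod_lessThan
        sum_distrib_left power2_eq_square)
  finally show ?thesis .
qed

text \<open>The Cameron--Martin formula. Both sides integrate against a product measure: translating
  coordinate \<open>i\<close> by \<open>v $ i\<close> moves the mean of its normal density, and so does weighting
  the centred density with the \<open>i\<close>-th factor of the exponential.\<close>

lemma gauss_noise_shift: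
  assumes \<sigma>: "\<sigma> > 0" and v: "v \<in> carrier_vec n" and h: "h \<in> borel_measurable (vec_borel n)"
  shows "(\<integral>\<^sup>+ e. h (v + e) \<partial>gauss_noise n \<sigma>) =
    (\<integral>\<^sup>+ e. h e * ennreal (exp ((v \<bullet> e - sqnorm v / 2) / \<sigma>\<^sup>2)) \<partial>gauss_noise n \<sigma>)"
proof -
  define N where "N = (\<lambda>i::nat. density lborel (normal_density 0 \<sigma>))"
  define Q where "Q = (\<lambda>i. density lborel (normal_density (v $ i) \<sigma>))"
  define L where "L = (\<lambda>i x. ennreal (exp ((v $ i * x - (v $ i)\<^sup>2 / 2) / \<sigma>\<^sup>2)))"
  define T where "T = (\<lambda>x. \<lambda>i\<in>{..<n}. v $ i + x i)"
  define PN where "PN = PiM {..<n} N"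
  interpret N: product_sigma_finite N
    unfolding N_def using product_sigma_finite_normal[OF \<sigma>] .
  interpret Q: product_sigma_finite Q
    unfolding Q_def using product_sigma_finite_normal[OF \<sigma>] .
  have setsN [simp]: "sets (N i) = sets borel" "space (N i) = UNIV" for i by (auto simp: N_def)
  have setsQ [simp]: "sets (Q i) = sets borel" for i by (auto simp: Q_def)
  have PiNQ: "sets PN = sets (PiM {..<n} Q)"
    unfolding PN_def by (rule sets_PiM_cong) auto
  have comp: "(\<lambda>x. x i) \<in> borel_measurable PN" if "i < n" for i
    using measurable_component_singleton[of i "{..<n}" N] that
    unfolding PN_def by (simp cong: measurable_cong_sets)
  have T: "T \<in> measurable PN PN"
  proof -
    have "T \<in> measurable PN (PiM {..<n} (\<lambda>_. borel))"
      unfolding T_def by (intro measurable_restrict borel_measurable_add comp) auto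
    moreover have "sets PN = sets (PiM {..<n} (\<lambda>_. borel))"
      unfolding PN_def by (rule sets_PiM_cong) auto
    ultimately show ?thesis by (simp cong: measurable_cong_sets)
  qed
  have Lm: "L i \<in> borel_measurable borel" for i unfolding L_def by measurable
  have Lprod: "(\<lambda>x. \<Prod>i<n. L i (x i)) \<in> borel_measurable PN"
    by (intro borel_measurable_prod_ennreal measurable_compose[OF comp Lm]) auto
  have Q1: "emeasure (Q i) A = (\<integral>\<^sup>+ x. L i x * indicator A x \<partial>N i)" if "A \<in> sets borel" for i A
  proof -
    have "(\<integral>\<^sup>+ x. L i x * indicator A x \<partial>N i) =
        (\<integral>\<^sup>+ x. ennreal (normal_density 0 \<sigma> x) * (L i x * indicator A x) \<partial>lborel)"
      unfolding N_def using that Lm by (subst nn_integral_density) auto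
    also have "\<dots> = (\<integral>\<^sup>+ x. ennreal (normal_density (v $ i) \<sigma> x) * indicator A x \<partial>lborel)"
      by (intro nn_integral_cong)
        (simp add: L_def ennreal_mult'[symmetric] mult.assoc[symmetric] normal_density_shift[OF \<sigma>])
    also have "\<dots> = emeasure (Q i) A"
      unfolding Q_def using that by (subst emeasure_density) auto
    finally show ?thesis ..
  qed
  have Q2: "emeasure (Q i) A = emeasure (N i) {x. v $ i + x \<in> A}" if [measurable]: "A \<in> sets borel" for i A
  proof -
    have "emeasure (Q i) A = (\<integral>\<^sup>+ x. ennreal (normal_density (v $ i) \<sigma> x) * indicator A x \<partial>lborel)"
      unfolding Q_def by (subst emeasure_density) auto
    also have "\<dots> = (\<integral>\<^sup>+ x. ennreal (normal_density (v $ i) \<sigma> (v $ i + 1 * x)) * indicator A (v $ i + 1 * x) \<partial>lborel)"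
      by (subst nn_integral_real_affine[where c = 1 and t = "v $ i"]) auto
    also have "\<dots> = (\<integral>\<^sup>+ x. ennreal (normal_density 0 \<sigma> x) * indicator {x. v $ i + x \<in> A} x \<partial>lborel)"
      by (intro nn_integral_cong) (auto simp: normal_density_def indicator_def)
    also have "\<dots> = emeasure (N i) {x. v $ i + x \<in> A}"
      unfolding N_def by (subst emeasure_density) auto
    finally show ?thesis .
  qed
  have "distr PN PN T = PiM {..<n} Q"
  proof (rule Q.PiM_eqI)
    fix A assume A: "\<And>i. i \<in> {..<n} \<Longrightarrow> A i \<in> sets (Q i)"
    then have A': "Pi\<^sub>E {..<n} A \<in> sets PN" unfolding PN_def by (auto intro!: sets_PiM_I_finite)
    have "emeasure (distr PN PN T) (Pi\<^sub>E {..<n} A) = emeasure PN (T -` Pi\<^sub>E {..<n} A \<inter> space PN)"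
      using T A' by (rule emeasure_distr)
    also have "T -` Pi\<^sub>E {..<n} A \<inter> space PN = Pi\<^sub>E {..<n} (\<lambda>i. {x. v $ i + x \<in> A i})"
    proof (rule Set.set_eqI)
      fix x :: "nat \<Rightarrow> real"
      have "T x \<in> Pi\<^sub>E {..<n} A \<longleftrightarrow> (\<forall>i<n. v $ i + x i \<in> A i)"
        unfolding T_def PiE_iff by (simp add: Ball_def)
      moreover have "x \<in> space PN \<longleftrightarrow> x \<in> extensional {..<n}"
        unfolding PN_def space_PiM PiE_iff by simp
      ultimately show "x \<in> T -` Pi\<^sub>E {..<n} A \<inter> space PN \<longleftrightarrow> x \<in> Pi\<^sub>E {..<n} (\<lambda>i. {x. v $ i + x \<in> A i})"
        unfolding vimage_def PiE_iff by auto
    qed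
    also have "emeasure PN \<dots> = (\<Prod>i<n. emeasure (N i) {x. v $ i + x \<in> A i})"
    proof -
      have "{x. v $ i + x \<in> A i} \<in> sets (N i)" if "i \<in> {..<n}" for i
      proof -
        have [measurable]: "A i \<in> sets borel" using A[OF that] by simp
        have "{x \<in> space borel. v $ i + x \<in> A i} \<in> sets borel" by measurable
        then show ?thesis by simp
      qed
      then show ?thesis unfolding PN_def by (intro N.emeasure_PiM) auto
    qed
    also have "\<dots> = (\<Prod>i<n. emeasure (Q i) (A i))"
      using A by (intro prod.cong) (auto simp: Q2)
    finally show "emeasure (distr PN PN T) (Pi\<^sub>E {..<n} A) = (\<Prod>i<n. emeasure (Q i) (A i))" .
  qed (auto simp: PiNQ)
  also have "\<dots> = density PN (\<lambda>x. \<Prod>i<n. L i (x i))"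
  proof (rule Q.PiM_eqI[symmetric])
    fix A assume A: "\<And>i. i \<in> {..<n} \<Longrightarrow> A i \<in> sets (Q i)"
    then have A': "Pi\<^sub>E {..<n} A \<in> sets PN" unfolding PN_def by (auto intro!: sets_PiM_I_finite)
    have "emeasure (density PN (\<lambda>x. \<Prod>i<n. L i (x i))) (Pi\<^sub>E {..<n} A) =
      (\<integral>\<^sup>+ x. (\<Prod>i<n. L i (x i)) * indicator (Pi\<^sub>E {..<n} A) x \<partial>PN)"
      using Lprod A' by (rule emeasure_density)
    also have "\<dots> = (\<integral>\<^sup>+ x. (\<Prod>i<n. L i (x i) * indicator (A i) (x i)) \<partial>PN)"
    proof (intro nn_integral_cong)
      fix x assume x: "x \<in> space PN"
      have "indicator (Pi\<^sub>E {..<n} A) x = (\<Prod>i<n. indicator (A i) (x i) :: ennreal)"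
      proof (cases "\<forall>i<n. x i \<in> A i")
        case True then show ?thesis using x by (auto simp: PN_def space_PiM PiE_iff indicator_def)
      next
        case False
        then obtain i where "i < n" "x i \<notin> A i" by auto
        then have "(\<Prod>i<n. indicator (A i) (x i) :: ennreal) = 0"
          by (intro prod_zero bexI[of _ i]) auto
        moreover have "x \<notin> Pi\<^sub>E {..<n} A" using False by (auto simp: PiE_iff)
        ultimately show ?thesis by simp
      qed
      then show "(\<Prod>i<n. L i (x i)) * indicator (Pi\<^sub>E {..<n} A) x =
          (\<Prod>i<n. L i (x i) * indicator (A i) (x i))"
        by (simp add: prod.distrib)
    qed
    also have "\<dots> = (\<Prod>i<n. \<integral>\<^sup>+ x. L i x * indicator (A i) x \<partial>N i)"
      unfolding PN_def
    proof (intro N.product_nn_integral_prod)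
      fix i assume "i \<in> {..<n}"
      then have [measurable]: "A i \<in> sets borel" using A by simp
      have "(\<lambda>x. L i x * indicator (A i) x) \<in> borel_measurable borel"
        using Lm[of i] by measurable
      then show "(\<lambda>x. L i x * indicator (A i) x) \<in> borel_measurable (N i)"
        by (simp cong: measurable_cong_sets)
    qed auto
    also have "\<dots> = (\<Prod>i<n. emeasure (Q i) (A i))"
      using A by (intro prod.cong) (auto simp: Q1)
    finally show "emeasure (density PN (\<lambda>x. \<Prod>i<n. L i (x i))) (Pi\<^sub>E {..<n} A) =
      (\<Prod>i<n. emeasure (Q i) (A i))" .
  qed (auto simp: PiNQ)
  finally have key: "distr PN PN T = density PN (\<lambda>x. \<Prod>i<n. L i (x i))" .
  have vecm: "Matrix.vec n \<in> measurable PN (vec_borel n)"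
    unfolding PN_def N_def by (rule measurable_vec_of_coords)
  have hm: "(\<lambda>x. h (Matrix.vec n x)) \<in> borel_measurable PN"
    using measurable_compose[OF vecm h] .
  have plus: "(\<lambda>e. v + e) \<in> measurable (vec_borel n) (vec_borel n)"
    using v by (intro measurable_vec_plus measurable_const measurable_ident) auto
  have Lv: "(\<Prod>i<n. L i (x i)) = ennreal (exp ((v \<bullet> Matrix.vec n x - sqnorm v / 2) / \<sigma>\<^sup>2))" for x
  proof -
    have "(v \<bullet> Matrix.vec n x - sqnorm v / 2) / \<sigma>\<^sup>2 = (\<Sum>i<n. (v $ i * x i - (v $ i)\<^sup>2 / 2) / \<sigma>\<^sup>2)"
      using v by (simp add: sqnorm_def scalar_prod_lessThan[of _ n] sum_subtractf
          sum_divide_distrib power2_eq_square diff_divide_distrib)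
    then show ?thesis by (simp add: L_def prod_ennreal exp_sum)
  qed
  have Lem: "(\<lambda>e. ennreal (exp ((v \<bullet> e - sqnorm v / 2) / \<sigma>\<^sup>2))) \<in> borel_measurable (vec_borel n)"
  proof -
    have [measurable]: "(\<lambda>e. v \<bullet> e) \<in> borel_measurable (vec_borel n)"
      using v by (intro measurable_scalar_prod measurable_const measurable_ident) auto
    show ?thesis by measurable
  qed
  have "(\<integral>\<^sup>+ e. h (v + e) \<partial>gauss_noise n \<sigma>) = (\<integral>\<^sup>+ x. h (v + Matrix.vec n x) \<partial>PN)"
    unfolding PN_def N_def using measurable_compose[OF plus h] by (rule nn_integral_gauss_noise)
  also have "\<dots> = (\<integral>\<^sup>+ x. h (Matrix.vec n (T x)) \<partial>PN)"
  proof (rule nn_integral_cong)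
    fix x
    have "v + Matrix.vec n x = Matrix.vec n (T x)" using v by (intro eq_vecI) (auto simp: T_def)
    then show "h (v + Matrix.vec n x) = h (Matrix.vec n (T x))" by simp
  qed
  also have "\<dots> = (\<integral>\<^sup>+ x. h (Matrix.vec n x) \<partial>distr PN PN T)"
    using T hm by (subst nn_integral_distr) auto
  also have "\<dots> = (\<integral>\<^sup>+ x. (\<Prod>i<n. L i (x i)) * h (Matrix.vec n x) \<partial>PN)"
    unfolding key using Lprod hm by (rule nn_integral_density)
  also have "\<dots> = (\<integral>\<^sup>+ x. h (Matrix.vec n x) *
      ennreal (exp ((v \<bullet> Matrix.vec n x - sqnorm v / 2) / \<sigma>\<^sup>2)) \<partial>PN)"
    by (simp add: Lv mult.commute)
  also have "\<dots> = (\<integral>\<^sup>+ e. h e * ennreal (exp ((v \<bullet> e - sqnorm v / 2) / \<sigma>\<^sup>2)) \<partial>gauss_noise n \<sigma>)"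
    unfolding PN_def N_def using h Lem
    by (subst nn_integral_gauss_noise) auto
  finally show ?thesis .
qed

lemma sqnorm_orthonormal_frame:
  assumes U: "U \<in> carrier_mat n d" "transpose_mat U * U = 1\<^sub>m d" and c: "c \<in> carrier_vec d"
  shows "sqnorm (U *\<^sub>v c) = sqnorm c"
proof -
  have "sqnorm (U *\<^sub>v c) = (transpose_mat U *\<^sub>v (U *\<^sub>v c)) \<bullet> c"
    unfolding sqnorm_def using U c by (subst transpose_vec_mult_scalar[of U n d]) auto
  also have "transpose_mat U *\<^sub>v (U *\<^sub>v c) = (transpose_mat U * U) *\<^sub>v c"
    using U c by (subst assoc_mult_mat_vec[of _ d n _ d]) auto
  finally show ?thesis unfolding U(2) sqnorm_def using c by simp
qed

lemma sqnorm_smult: "sqnorm (a \<cdot>\<^sub>v v) = a\<^sup>2 * sqnorm v"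
  by (simp add: sqnorm_def scalar_prod_def sum_distrib_left power2_eq_square ac_simps)

text \<open>The columns of \<open>U\<close> are orthonormal, so \<open>transpose_mat U *\<^sub>v e\<close> is a standard
  Gaussian vector of dimension \<open>d\<close> up to the factor \<open>\<sigma>\<close>; the claim is the moment generating
  function of its squared length. Rotation invariance of the Gaussian law is not established
  separately. Instead the square in the exponent is linearized by an auxiliary standard Gaussian
  vector \<open>g\<close>: the integral of \<open>exp (z \<bullet> g)\<close> over \<open>g\<close> is
  \<open>exp (sqnorm z / 2)\<close>. After exchanging the integrals, the one over \<open>e\<close> depends only on the
  length of \<open>U *\<^sub>v g\<close>, which is that of \<open>g\<close>, and what remains factorizes over the
  coordinates of \<open>g\<close>.\<close>

lemma gauss_noise_chi_square_mgf:
  assumes \<sigma>: "\<sigma> > 0" and t: "0 \<le> t" "t < 1"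
    and U: "U \<in> carrier_mat n d" "transpose_mat U * U = 1\<^sub>m d"
  shows "(\<integral>\<^sup>+ e. ennreal (exp (t / (2 * \<sigma>\<^sup>2) * sqnorm (transpose_mat U *\<^sub>v e))) \<partial>gauss_noise n \<sigma>)
    = ennreal ((1 - t) powr (- real d / 2))"
proof -
  have pow: "(1 / sqrt (1 - t)) ^ d = (1 - t) powr (- real d / 2)"
  proof -
    have "1 / sqrt (1 - t) = (1 - t) powr (- (1 / 2))"
      using t by (simp add: powr_minus_divide powr_half_sqrt)
    moreover have "((1 - t) powr (- (1 / 2))) ^ d = ((1 - t) powr (- (1 / 2))) powr real d"
      using t by (intro powr_realpow[symmetric]) simp
    ultimately show ?thesis by (simp only: powr_powr) (simp add: field_simps)
  qed
  \<comment> \<open>The scale at which integrating out \<open>g\<close> reproduces the exponent \<open>t / (2 * \<sigma>\<^sup>2)\<close>.\<close>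
  define b where "b = sqrt t / \<sigma>"
  have b2: "b\<^sup>2 = t / \<sigma>\<^sup>2" using t by (simp add: b_def power_divide)
  have Ut: "transpose_mat U \<in> carrier_mat d n" using U by auto
  interpret G: prob_space "gauss_noise d 1" by (rule prob_space_gauss_noise) simp
  interpret E: prob_space "gauss_noise n \<sigma>" using \<sigma> by (rule prob_space_gauss_noise)
  interpret pair_sigma_finite "gauss_noise n \<sigma>" "gauss_noise d 1" ..
  have pm: "(\<lambda>(e, g). ennreal (exp ((b \<cdot>\<^sub>v (transpose_mat U *\<^sub>v e)) \<bullet> g)))
      \<in> borel_measurable (gauss_noise n \<sigma> \<Otimes>\<^sub>M gauss_noise d 1)"
  proof -
    have 1: "(\<lambda>x. transpose_mat U *\<^sub>v fst x) \<in> measurable (gauss_noise n \<sigma> \<Otimes>\<^sub>M gauss_noise d 1) (vec_borel d)"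
      using measurable_fst[of "gauss_noise n \<sigma>" "gauss_noise d 1"]
      by (intro measurable_mult_mat_vec[OF Ut])
        (simp only: measurable_cong_sets[OF refl sets_gauss_noise])
    have 2: "snd \<in> measurable (gauss_noise n \<sigma> \<Otimes>\<^sub>M gauss_noise d 1) (vec_borel d)"
      using measurable_snd[of "gauss_noise n \<sigma>" "gauss_noise d 1"]
      by (simp only: measurable_cong_sets[OF refl sets_gauss_noise])
    have 3: "(\<lambda>x. ennreal (exp (b * ((transpose_mat U *\<^sub>v fst x) \<bullet> snd x)))) \<in> borel_measurable (gauss_noise n \<sigma> \<Otimes>\<^sub>M gauss_noise d 1)"
      using measurable_scalar_prod[OF 1 2] by measurable
    show ?thesis
      by (rule measurable_cong[THEN iffD1, OF _ 3])
        (use U in \<open>auto simp: space_pair_measure smult_scalar_prod_distrib[of _ d]\<close>)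
  qed
  have linearize: "(\<integral>\<^sup>+ e. ennreal (exp (t / (2 * \<sigma>\<^sup>2) * sqnorm (transpose_mat U *\<^sub>v e))) \<partial>gauss_noise n \<sigma>) =
    (\<integral>\<^sup>+ e. (\<integral>\<^sup>+ g. ennreal (exp ((b \<cdot>\<^sub>v (transpose_mat U *\<^sub>v e)) \<bullet> g)) \<partial>gauss_noise d 1) \<partial>gauss_noise n \<sigma>)"
  proof (intro nn_integral_cong)
    fix e assume "e \<in> space (gauss_noise n \<sigma>)"
    then have e: "transpose_mat U *\<^sub>v e \<in> carrier_vec d" using U by auto
    then have "1\<^sup>2 / 2 * sqnorm (b \<cdot>\<^sub>v (transpose_mat U *\<^sub>v e)) =
        t / (2 * \<sigma>\<^sup>2) * sqnorm (transpose_mat U *\<^sub>v e)"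
      unfolding sqnorm_smult b2 by simp
    then show "ennreal (exp (t / (2 * \<sigma>\<^sup>2) * sqnorm (transpose_mat U *\<^sub>v e))) =
        (\<integral>\<^sup>+ g. ennreal (exp ((b \<cdot>\<^sub>v (transpose_mat U *\<^sub>v e)) \<bullet> g)) \<partial>gauss_noise d 1)"
      using e by (subst gauss_noise_mgf) auto
  qed
  have swap: "\<dots> = (\<integral>\<^sup>+ g. (\<integral>\<^sup>+ e. ennreal (exp ((b \<cdot>\<^sub>v (transpose_mat U *\<^sub>v e)) \<bullet> g)) \<partial>gauss_noise n \<sigma>) \<partial>gauss_noise d 1)"
    using Fubini'[OF pm] by simp
  have integrate_out: "\<dots> = (\<integral>\<^sup>+ g. ennreal (exp (t / 2 * sqnorm g)) \<partial>gauss_noise d 1)"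
  proof (intro nn_integral_cong)
    fix g assume "g \<in> space (gauss_noise d 1)"
    then have g: "g \<in> carrier_vec d" by simp
    have "(\<integral>\<^sup>+ e. ennreal (exp ((b \<cdot>\<^sub>v (transpose_mat U *\<^sub>v e)) \<bullet> g)) \<partial>gauss_noise n \<sigma>) =
      (\<integral>\<^sup>+ e. ennreal (exp ((b \<cdot>\<^sub>v (U *\<^sub>v g)) \<bullet> e)) \<partial>gauss_noise n \<sigma>)"
    proof (intro nn_integral_cong)
      fix e assume "e \<in> space (gauss_noise n \<sigma>)"
      then have e: "e \<in> carrier_vec n" by simp
      have Ug: "U *\<^sub>v g \<in> carrier_vec n" using U by auto
      have "(b \<cdot>\<^sub>v (transpose_mat U *\<^sub>v e)) \<bullet> g = b * ((transpose_mat U *\<^sub>v e) \<bullet> g)"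
        using Ut e g by (intro smult_scalar_prod_distrib[of _ d]) auto
      also have "\<dots> = b * (e \<bullet> (U *\<^sub>v g))"
        using U g e by (subst transpose_vec_mult_scalar) auto
      also have "\<dots> = (b \<cdot>\<^sub>v (U *\<^sub>v g)) \<bullet> e"
        using Ug e by (simp add: comm_scalar_prod[of e n])
      finally show "ennreal (exp ((b \<cdot>\<^sub>v (transpose_mat U *\<^sub>v e)) \<bullet> g)) = ennreal (exp ((b \<cdot>\<^sub>v (U *\<^sub>v g)) \<bullet> e))"
        by simp
    qed
    also have "\<dots> = ennreal (exp (\<sigma>\<^sup>2 / 2 * sqnorm (b \<cdot>\<^sub>v (U *\<^sub>v g))))"
      using \<sigma> U by (intro gauss_noise_mgf) auto
    also have "\<dots> = ennreal (exp (t / 2 * sqnorm g))"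
      using \<sigma> by (simp add: sqnorm_smult b2 sqnorm_orthonormal_frame[OF U g])
    finally show "(\<integral>\<^sup>+ e. ennreal (exp ((b \<cdot>\<^sub>v (transpose_mat U *\<^sub>v e)) \<bullet> g)) \<partial>gauss_noise n \<sigma>) =
      ennreal (exp (t / 2 * sqnorm g))" .
  qed
  have factorize: "\<dots> = (\<integral>\<^sup>+ g. (\<Prod>i<d. ennreal (exp (t / 2 * (g $ i)\<^sup>2))) \<partial>gauss_noise d 1)"
    by (intro nn_integral_cong)
      (simp add: sqnorm_def scalar_prod_lessThan prod_ennreal exp_sum[symmetric] sum_distrib_left power2_eq_square)
  have coords: "\<dots> = (\<Prod>i<d. ennreal (1 / sqrt (1 - t)))"
    unfolding nn_integral_exp_square_normal[OF t, symmetric]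
    by (rule nn_integral_gauss_noise_prod[where f = "\<lambda>i x. ennreal (exp (t / 2 * x\<^sup>2))"]) auto
  have total: "\<dots> = ennreal ((1 - t) powr (- real d / 2))"
    using t by (simp add: ennreal_power pow)
  show ?thesis
    unfolding linearize swap integrate_out factorize coords total ..
qed


section \<open>Model spaces and orthonormal frames\<close>

lemma mat_mult_assoc_dim:
  fixes A B C :: "'a :: semiring_0 mat"
  assumes "dim_col A = dim_row B" "dim_col B = dim_row C"
  shows "A * B * C = A * (B * C)"
  using assms by (intro assoc_mult_mat[of _ "dim_row A" "dim_col A" _ "dim_col B" _ "dim_col C"]) auto

lemma mat_vec_mult_assoc_dim:
  fixes A B :: "'a :: semiring_0 mat"
  assumes "dim_col A = dim_row B" "dim_col B = dim_vec v"
  shows "(A * B) *\<^sub>v v = A *\<^sub>v (B *\<^sub>v v)"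
  using assms by (intro assoc_mult_mat_vec[of _ "dim_row A" "dim_col A" _ "dim_col B"]) auto

lemma mat_mult_unit_vec:
  fixes A :: "'a :: semiring_1 mat"
  assumes "A \<in> carrier_mat n p" "j < p"
  shows "A *\<^sub>v unit_vec p j = col A j"
  using assms by (intro eq_vecI) auto

lemma sqnorm_nonneg [simp]: "sqnorm v \<ge> 0"
  by (simp add: sqnorm_def scalar_prod_def sum_nonneg)

lemma sqnorm_eq_0: "v \<in> carrier_vec n \<Longrightarrow> sqnorm v = 0 \<longleftrightarrow> v = 0\<^sub>v n"
  unfolding sqnorm_def scalar_prod_def by (auto simp: sum_nonneg_eq_0_iff)

lemma sqnorm_minus:
  assumes "v \<in> carrier_vec n" "w \<in> carrier_vec n"
  shows "sqnorm (v - w) = sqnorm v - 2 * (v \<bullet> w) + sqnorm w"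
  using assms by (simp add: sqnorm_def scalar_prod_minus_distrib[of _ n] minus_scalar_prod_distrib[of _ n]
      comm_scalar_prod[of w n v])

lemma finite_supp [simp]: "finite (supp b)"
  by (simp add: supp_def)

lemma supp_zero [simp]: "supp (0\<^sub>v p) = {}"
  by (auto simp: supp_def)

lemma supp_subset_iff: "b \<in> carrier_vec p \<Longrightarrow> supp b \<subseteq> J \<longleftrightarrow> (\<forall>j<p. j \<notin> J \<longrightarrow> b $ j = 0)"
  by (auto simp: supp_def)


text \<open>The mean vectors that the model \<open>J\<close> can represent: the span of its columns.\<close>

definition model_space :: "real mat \<Rightarrow> nat set \<Rightarrow> real Matrix.vec set" where
  "model_space X J = {X *\<^sub>v b |b. b \<in> carrier_vec (dim_col X) \<and> supp b \<subseteq> J}"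

lemma model_spaceI:
  "X \<in> carrier_mat n p \<Longrightarrow> b \<in> carrier_vec p \<Longrightarrow> supp b \<subseteq> J \<Longrightarrow> X *\<^sub>v b \<in> model_space X J"
  unfolding model_space_def by auto

lemma model_spaceE:
  assumes "X \<in> carrier_mat n p" "z \<in> model_space X J"
  obtains b where "b \<in> carrier_vec p" "supp b \<subseteq> J" "z = X *\<^sub>v b"
  using assms unfolding model_space_def by auto

lemma model_space_diff:
  assumes X: "X \<in> carrier_mat n p" and "z \<in> model_space X J" "w \<in> model_space X K"
  shows "z - w \<in> model_space X (J \<union> K)"
proof -
  obtain b where b: "b \<in> carrier_vec p" "supp b \<subseteq> J" "z = X *\<^sub>v b"
    using X assms(2) by (rule model_spaceE)
  obtain c where c: "c \<in> carrier_vec p" "supp c \<subseteq> K" "w = X *\<^sub>v c"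
    using X assms(3) by (rule model_spaceE)
  have "z - w = X *\<^sub>v (b - c)"
    using X b c by (simp add: mult_minus_distrib_mat_vec)
  moreover have "supp (b - c) \<subseteq> J \<union> K"
    using b c by (subst supp_subset_iff[of _ p]) (auto simp: supp_subset_iff[of _ p])
  ultimately show ?thesis
    using X b c by (auto intro!: model_spaceI)
qed

definition indep_on :: "real mat \<Rightarrow> nat set \<Rightarrow> bool" where
  "indep_on X J \<longleftrightarrow> (\<forall>b\<in>carrier_vec (dim_col X). supp b \<subseteq> J \<longrightarrow> X *\<^sub>v b = 0\<^sub>v (dim_row X) \<longrightarrow> b = 0\<^sub>v (dim_col X))"

text \<open>A nonzero sparse vector in the kernel would make the minimal sparse eigenvalue, and with it
  the ratio, vanish.\<close>

lemma indep_on_if_tau_pos: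
  assumes tau: "tau X r > 0" and J: "finite J" "card J \<le> r"
  shows "indep_on X J"
  unfolding indep_on_def
proof (intro ballI impI, rule ccontr)
  fix b assume b: "b \<in> carrier_vec (dim_col X)" "supp b \<subseteq> J" "X *\<^sub>v b = 0\<^sub>v (dim_row X)"
    and nz: "b \<noteq> 0\<^sub>v (dim_col X)"
  have "supp b \<noteq> {}"
    using b(1) nz by (auto simp: supp_def intro!: eq_vecI)
  then have "card (supp b) \<in> {1..r}"
    using card_mono[OF J(1) b(2)] J(2) by (simp add: Suc_le_eq card_gt_0_iff)
  moreover have "sqnorm (X *\<^sub>v b) = 0" unfolding b(3) by (simp add: sqnorm_def)
  ultimately have "0 \<in> sparse_quotients X r"
    unfolding sparse_quotients_def using b(1) by (intro image_eqI[of _ _ b]) auto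
  then have "phi_min X r = 0"
    unfolding phi_min_def by (rule cInf_eq_minimum) (auto simp: sparse_quotients_def)
  then show False using tau by (simp add: tau_def)
qed

text \<open>One Gram--Schmidt step. Orthonormality of the columns is kept in the matrix form
  \<open>transpose_mat U * U = 1\<^sub>m d\<close>, in which all later computations use it.\<close>

lemma orthonormal_frame_extend:
  fixes U :: "real mat"
  assumes U: "U \<in> carrier_mat n d" "transpose_mat U * U = 1\<^sub>m d"
    and w: "w \<in> carrier_vec n" "transpose_mat U *\<^sub>v w = 0\<^sub>v d" "w \<noteq> 0\<^sub>v n"
  obtains U' where "U' \<in> carrier_mat n (Suc d)" "transpose_mat U' * U' = 1\<^sub>m (Suc d)"
    "{U' *\<^sub>v c |c. c \<in> carrier_vec (Suc d)} = {U *\<^sub>v c + a \<cdot>\<^sub>v w |c a. c \<in> carrier_vec d}"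
proof -
  define s where "s = sqrt (sqnorm w)"
  have "sqnorm w > 0"
    using w(3) sqnorm_eq_0[OF w(1)] sqnorm_nonneg[of w] by linarith
  then have s: "s > 0" "s * s = w \<bullet> w" by (auto simp: s_def sqnorm_def)
  define q where "q = (1 / s) \<cdot>\<^sub>v w"
  have q: "q \<in> carrier_vec n" "q \<bullet> q = 1"
    using w(1) s by (auto simp: q_def field_simps)
  have Uq: "col U k \<bullet> q = 0" "q \<bullet> col U k = 0" if "k < d" for k
  proof -
    have "(transpose_mat U *\<^sub>v w) $ k = 0" unfolding w(2) using that by simp
    then have *: "col U k \<bullet> w = 0" using that U by simp
    then show "col U k \<bullet> q = 0" using w(1) U by (simp add: q_def)
    then show "q \<bullet> col U k = 0" using q U that by (subst comm_scalar_prod[of _ n]) auto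
  qed
  have UU: "col U k \<bullet> col U l = (if k = l then 1 else 0)" if "k < d" "l < d" for k l
  proof -
    have "(transpose_mat U * U) $$ (k, l) = (if k = l then 1 else 0)"
      unfolding U(2) using that by simp
    moreover have "(transpose_mat U * U) $$ (k, l) = col U k \<bullet> col U l"
      using that U(1) by simp
    ultimately show ?thesis by simp
  qed
  define U' where "U' = mat n (Suc d) (\<lambda>(i, k). if k < d then U $$ (i, k) else q $ i)"
  have col: "col U' k = (if k < d then col U k else q)" if "k < Suc d" for k
    using that U q by (intro eq_vecI) (auto simp: U'_def)
  have U': "U' \<in> carrier_mat n (Suc d)" by (simp add: U'_def)
  have "transpose_mat U' * U' = 1\<^sub>m (Suc d)"
    using U' q by (intro eq_matI) (auto simp: col UU Uq less_Suc_eq)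
  moreover have mult: "U' *\<^sub>v c = U *\<^sub>v Matrix.vec d (\<lambda>k. c $ k) + c $ d \<cdot>\<^sub>v q" if c: "c \<in> carrier_vec (Suc d)" for c
    using U U' c q
    by (intro eq_vecI) (auto simp: scalar_prod_def U'_def intro!: sum.cong)
  moreover have "{U' *\<^sub>v c |c. c \<in> carrier_vec (Suc d)} = {U *\<^sub>v c + a \<cdot>\<^sub>v w |c a. c \<in> carrier_vec d}"
  proof safe
    fix c :: "real Matrix.vec" assume "c \<in> carrier_vec (Suc d)"
    then show "\<exists>c' a. U' *\<^sub>v c = U *\<^sub>v c' + a \<cdot>\<^sub>v w \<and> c' \<in> carrier_vec d"
      by (intro exI[of _ "Matrix.vec d (\<lambda>k. c $ k)"] exI[of _ "c $ d / s"])
        (auto simp: mult q_def smult_smult_assoc)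
  next
    fix c :: "real Matrix.vec" and a assume c: "c \<in> carrier_vec d"
    define c' where "c' = Matrix.vec (Suc d) (\<lambda>k. if k < d then c $ k else a * s)"
    have "Matrix.vec d (\<lambda>k. c' $ k) = c" using c by (intro eq_vecI) (auto simp: c'_def)
    moreover have "c' $ d \<cdot>\<^sub>v q = a \<cdot>\<^sub>v w" using s by (simp add: c'_def q_def smult_smult_assoc)
    ultimately show "\<exists>c'. U *\<^sub>v c + a \<cdot>\<^sub>v w = U' *\<^sub>v c' \<and> c' \<in> carrier_vec (Suc d)"
      using mult[of c'] by (intro exI[of _ c']) (auto simp: c'_def)
  qed
  ultimately show thesis using U' that by blast
qed

lemma model_space_insert:
  assumes X: "X \<in> carrier_mat n p" and j: "j < p"
  shows "model_space X (insert j J) = {z + a \<cdot>\<^sub>v col X j |z a. z \<in> model_space X J}"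
proof safe
  fix z assume "z \<in> model_space X (insert j J)"
  then obtain b where b: "b \<in> carrier_vec p" "supp b \<subseteq> insert j J" "z = X *\<^sub>v b"
    using X by (elim model_spaceE)
  define b' where "b' = b - b $ j \<cdot>\<^sub>v unit_vec p j"
  have "supp b' \<subseteq> J"
    using b j by (auto simp: b'_def supp_def split: if_splits)
  moreover have "b = b' + b $ j \<cdot>\<^sub>v unit_vec p j"
    using b by (intro eq_vecI) (auto simp: b'_def)
  then have "z = X *\<^sub>v (b' + b $ j \<cdot>\<^sub>v unit_vec p j)"
    unfolding b(3) by (rule arg_cong)
  then have "z = X *\<^sub>v b' + b $ j \<cdot>\<^sub>v col X j"
    using b(1) j
    by (simp add: mult_add_distrib_mat_vec[OF X] mult_mat_vec[OF X] mat_mult_unit_vec[OF X] b'_def)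
  ultimately show "\<exists>z' a. z = z' + a \<cdot>\<^sub>v col X j \<and> z' \<in> model_space X J"
    using X b(1) by (intro exI[of _ "X *\<^sub>v b'"] exI[of _ "b $ j"]) (auto intro!: model_spaceI simp: b'_def)
next
  fix z a assume "z \<in> model_space X J"
  then obtain b where b: "b \<in> carrier_vec p" "supp b \<subseteq> J" "z = X *\<^sub>v b"
    using X by (elim model_spaceE)
  have "z + a \<cdot>\<^sub>v col X j = X *\<^sub>v (b + a \<cdot>\<^sub>v unit_vec p j)"
    unfolding b(3) using b(1) j
    by (simp add: mult_add_distrib_mat_vec[OF X] mult_mat_vec[OF X] mat_mult_unit_vec[OF X])
  moreover have "supp (b + a \<cdot>\<^sub>v unit_vec p j) \<subseteq> insert j J"
    using b j by (auto simp: supp_def split: if_splits)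
  ultimately show "z + a \<cdot>\<^sub>v col X j \<in> model_space X (insert j J)"
    using X b(1) by (auto intro!: model_spaceI)
qed

text \<open>Gram--Schmidt over the columns in \<open>J\<close>: a column enlarges the frame unless it already lies
  in the span. The upper bounds use \<open>d \<le> card J\<close> for unions of two models, whose
  columns may be dependent; the lower bound needs \<open>d = card J\<close>.\<close>

lemma orthonormal_frame_exists:
  assumes X: "X \<in> carrier_mat n p" and J: "finite J" "J \<subseteq> {..<p}"
  shows "\<exists>d\<le>card J. \<exists>U\<in>carrier_mat n d. transpose_mat U * U = 1\<^sub>m d \<and>
    model_space X J = {U *\<^sub>v c |c. c \<in> carrier_vec d} \<and> (indep_on X J \<longrightarrow> d = card J)"
  using J
proof (induction J)
  case empty
  define U :: "real mat" where "U = 0\<^sub>m n 0"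
  have 0: "X *\<^sub>v 0\<^sub>v p = 0\<^sub>v n" "U *\<^sub>v 0\<^sub>v 0 = 0\<^sub>v n"
    using X by (auto simp: U_def intro!: eq_vecI)
  have e: "supp b \<subseteq> {} \<longleftrightarrow> b = 0\<^sub>v p" if "b \<in> carrier_vec p" for b
    using that by (subst supp_subset_iff[OF that]) (auto intro!: eq_vecI)
  have "model_space X {} = {0\<^sub>v n}"
    using X e 0 by (auto simp: model_space_def intro!: exI[of _ "0\<^sub>v p"])
  moreover have "{U *\<^sub>v c |c. c \<in> carrier_vec 0} = {0\<^sub>v n}"
  proof -
    have "U *\<^sub>v c = 0\<^sub>v n" if "c \<in> carrier_vec 0" for c
      using that by (intro eq_vecI) (auto simp: U_def scalar_prod_def)
    then have "{U *\<^sub>v c |c. c \<in> carrier_vec 0} \<subseteq> {0\<^sub>v n}" by auto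
    moreover have "0\<^sub>v n \<in> {U *\<^sub>v c |c. c \<in> carrier_vec 0}"
      by (rule CollectI, rule exI[of _ "0\<^sub>v 0"], rule conjI, rule 0(2)[symmetric], rule zero_carrier_vec)
    ultimately show ?thesis by (intro equalityI) simp_all
  qed
  moreover have "transpose_mat U * U = 1\<^sub>m 0" "U \<in> carrier_mat n 0"
    by (auto simp: U_def)
  ultimately show ?case by (intro exI[of _ 0]) auto
next
  case (insert j J)
  then have j: "j < p" by auto
  from insert.IH insert.prems obtain d U where d: "d \<le> card J" and U: "U \<in> carrier_mat n d" "transpose_mat U * U = 1\<^sub>m d"
    and sp: "model_space X J = {U *\<^sub>v c |c. c \<in> carrier_vec d}" and ind: "indep_on X J \<longrightarrow> d = card J"
    by auto
  define x where "x = col X j"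
  define c0 where "c0 = transpose_mat U *\<^sub>v x"
  define w where "w = x - U *\<^sub>v c0"
  have x: "x \<in> carrier_vec n" using X by (auto simp: x_def)
  have c0: "c0 \<in> carrier_vec d" using U by (auto simp: c0_def)
  have w: "w \<in> carrier_vec n" using U by (auto simp: w_def x)
  have "transpose_mat U *\<^sub>v (U *\<^sub>v c0) = (transpose_mat U * U) *\<^sub>v c0"
    using U(1) c0 by (subst assoc_mult_mat_vec[of _ d n _ d]) auto
  then have UUc0: "transpose_mat U *\<^sub>v (U *\<^sub>v c0) = c0"
    unfolding U(2) using c0 by simp
  have "transpose_mat U *\<^sub>v w = transpose_mat U *\<^sub>v x - transpose_mat U *\<^sub>v (U *\<^sub>v c0)"
    unfolding w_def using U(1) x by (intro mult_minus_distrib_mat_vec[of _ d n]) auto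
  then have Uw: "transpose_mat U *\<^sub>v w = 0\<^sub>v d"
    unfolding UUc0 c0_def[symmetric] using c0 by simp
  have sp': "model_space X (insert j J) = {U *\<^sub>v c + a \<cdot>\<^sub>v w |c a. c \<in> carrier_vec d}"
  proof -
    have eq: "U *\<^sub>v c + a \<cdot>\<^sub>v x = U *\<^sub>v (c + a \<cdot>\<^sub>v c0) + a \<cdot>\<^sub>v w" if "c \<in> carrier_vec d" for c a
    proof -
      have "U *\<^sub>v (c + a \<cdot>\<^sub>v c0) = U *\<^sub>v c + a \<cdot>\<^sub>v (U *\<^sub>v c0)"
        using U c0 that by (simp add: mult_add_distrib_mat_vec[OF U(1)] mult_mat_vec[OF U(1)])
      then show ?thesis
        using U x that by (intro eq_vecI) (auto simp: w_def algebra_simps)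
    qed
    have eq': "U *\<^sub>v c + a \<cdot>\<^sub>v w = U *\<^sub>v (c - a \<cdot>\<^sub>v c0) + a \<cdot>\<^sub>v x" if "c \<in> carrier_vec d" for c a
    proof -
      have "U *\<^sub>v (c - a \<cdot>\<^sub>v c0) = U *\<^sub>v c - a \<cdot>\<^sub>v (U *\<^sub>v c0)"
        using U c0 that by (simp add: mult_minus_distrib_mat_vec[OF U(1)] mult_mat_vec[OF U(1)])
      then show ?thesis
        using U x that by (intro eq_vecI) (auto simp: w_def algebra_simps)
    qed
    show ?thesis
    proof (intro Set.set_eqI iffI)
      fix z assume "z \<in> model_space X (insert j J)"
      then obtain c a where c: "c \<in> carrier_vec d" and z: "z = U *\<^sub>v c + a \<cdot>\<^sub>v x"
        unfolding model_space_insert[OF X j] sp x_def[symmetric] by blast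
      have "c + a \<cdot>\<^sub>v c0 \<in> carrier_vec d" using c c0 by simp
      then show "z \<in> {U *\<^sub>v c + a \<cdot>\<^sub>v w |c a. c \<in> carrier_vec d}"
        unfolding z eq[OF c] by blast
    next
      fix z assume "z \<in> {U *\<^sub>v c + a \<cdot>\<^sub>v w |c a. c \<in> carrier_vec d}"
      then obtain c a where c: "c \<in> carrier_vec d" and z: "z = U *\<^sub>v c + a \<cdot>\<^sub>v w" by blast
      have "c - a \<cdot>\<^sub>v c0 \<in> carrier_vec d" using c c0 by simp
      then show "z \<in> model_space X (insert j J)"
        unfolding z eq'[OF c] model_space_insert[OF X j] sp x_def[symmetric] by blast
    qed
  qed
  show ?case
  proof (cases "w = 0\<^sub>v n")
    case True
    have "U *\<^sub>v c + a \<cdot>\<^sub>v 0\<^sub>v n = U *\<^sub>v c" for c a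
      using U(1) by (intro eq_vecI) auto
    then have "model_space X (insert j J) = {U *\<^sub>v c |c. c \<in> carrier_vec d}"
      unfolding sp' True by simp
    moreover have "\<not> indep_on X (insert j J)"
    proof
      assume i: "indep_on X (insert j J)"
      have "x = U *\<^sub>v c0"
      proof (intro eq_vecI)
        fix i assume "i < dim_vec (U *\<^sub>v c0)"
        then show "x $ i = (U *\<^sub>v c0) $ i"
          using arg_cong[OF True, of "\<lambda>v. v $ i"] U x by (auto simp: w_def)
      qed (use U x in auto)
      then have "x \<in> model_space X J" unfolding sp using c0 by blast
      then obtain b where b: "b \<in> carrier_vec p" "supp b \<subseteq> J" "x = X *\<^sub>v b"
        using X by (elim model_spaceE)
      have "X *\<^sub>v (unit_vec p j - b) = 0\<^sub>v n"
        using X b x j by (subst mult_minus_distrib_mat_vec[OF X]) (auto simp: mat_mult_unit_vec[OF X] x_def[symmetric])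
      moreover have "supp (unit_vec p j - b) \<subseteq> insert j J"
        using b j by (subst supp_subset_iff[of _ p]) (auto simp: supp_subset_iff[of _ p])
      ultimately have "unit_vec p j - b = 0\<^sub>v p"
        using i X b(1) by (auto simp: indep_on_def)
      then have "(unit_vec p j - b) $ j = 0" using j by simp
      then have "b $ j = 1" using j b(1) by simp
      then show False using insert.hyps b j by (auto simp: supp_def)
    qed
    ultimately show ?thesis
      using d U insert.hyps by (intro exI[of _ d] conjI bexI[of _ U]) simp_all
  next
    case False
    obtain U' where U': "U' \<in> carrier_mat n (Suc d)" "transpose_mat U' * U' = 1\<^sub>m (Suc d)"
      "{U' *\<^sub>v c |c. c \<in> carrier_vec (Suc d)} = {U *\<^sub>v c + a \<cdot>\<^sub>v w |c a. c \<in> carrier_vec d}"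
      using orthonormal_frame_extend[OF U w Uw False] .
    moreover have "indep_on X (insert j J) \<Longrightarrow> indep_on X J"
      by (auto simp: indep_on_def)
    ultimately show ?thesis
      unfolding sp' using d ind insert.hyps
      by (intro exI[of _ "Suc d"] conjI bexI[of _ U']) auto
  qed
qed



section \<open>Least squares\<close>

text \<open>Both candidates yield the same orthogonal projections \<open>A * B = A * C\<close> and
  \<open>B * A = C * A\<close>, and \<open>B * A * B = B\<close> recovers the candidate from them.\<close>

lemma moore_penrose_unique:
  assumes B: "is_moore_penrose A B" and C: "is_moore_penrose A C"
  shows "B = C"
proof -
  have dB: "dim_row B = dim_col A" "dim_col B = dim_row A"
    and dC: "dim_row C = dim_col A" "dim_col C = dim_row A"
    using B C by (auto simp: is_moore_penrose_def)
  note B' = B[unfolded is_moore_penrose_def] and C' = C[unfolded is_moore_penrose_def]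
  have "A * B = (A * C) * (A * B)"
    using C' dB dC by (metis index_mult_mat(2,3) mat_mult_assoc_dim)
  then have "transpose_mat (A * B) = transpose_mat (A * B) * transpose_mat (A * C)"
    using dB dC by (metis carrier_matI index_mult_mat(2,3) transpose_mult)
  then have "A * B = (A * B) * (A * C)" using B' C' by simp
  also have "\<dots> = A * C"
    using B' dB dC by (metis index_mult_mat(2,3) mat_mult_assoc_dim)
  finally have AB: "A * B = A * C" .
  have "B * A = (B * A) * (C * A)"
    using C' dB dC by (metis index_mult_mat(2,3) mat_mult_assoc_dim)
  then have "transpose_mat (B * A) = transpose_mat (C * A) * transpose_mat (B * A)"
    using dB dC by (metis carrier_matI index_mult_mat(2,3) transpose_mult)
  then have "B * A = (C * A) * (B * A)" using B' C' by simp
  also have "\<dots> = C * A"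
    using B' dB dC by (metis index_mult_mat(2,3) mat_mult_assoc_dim)
  finally have BA: "B * A = C * A" .
  have "B = B * (A * B)" using B' dB by (metis mat_mult_assoc_dim)
  also have "\<dots> = (B * A) * C" unfolding AB using dB dC by (metis mat_mult_assoc_dim)
  also have "\<dots> = C" unfolding BA using C' by simp
  finally show ?thesis .
qed

lemma pinv_eqI: "is_moore_penrose A B \<Longrightarrow> pinv A = B"
  unfolding pinv_def by (rule the_equality) (auto intro: moore_penrose_unique)

lemma mat_diag_mult_vec:
  "b \<in> carrier_vec p \<Longrightarrow> mat_diag p f *\<^sub>v b = Matrix.vec p (\<lambda>j. f j * b $ j)"
  by (intro eq_vecI) (auto simp: mat_diag_def scalar_prod_def if_distrib[of "\<lambda>x. x * _"] if_distribR cong: if_cong)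

context
  fixes X :: "real mat" and n p :: nat and M :: "nat set"
  assumes X: "X \<in> carrier_mat n p" and indep: "indep_on X M"
begin

abbreviation "coord_proj \<equiv> mat_diag p (\<lambda>j. if j \<in> M then 1 else 0 :: real)"
abbreviation "gram \<equiv> coord_proj * transpose_mat X * X * coord_proj"

lemma coord_proj_carrier: "coord_proj \<in> carrier_mat p p" by (simp add: mat_diag_def)

lemma coord_proj_dims [simp]: "dim_row coord_proj = p" "dim_col coord_proj = p" by (auto simp: mat_diag_def)

lemma coord_proj_transpose: "transpose_mat coord_proj = coord_proj" by (intro eq_matI) (auto simp: mat_diag_def)

lemma coord_proj_vec: "b \<in> carrier_vec p \<Longrightarrow> coord_proj *\<^sub>v b = Matrix.vec p (\<lambda>j. if j \<in> M then b $ j else 0)"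
  by (auto simp: mat_diag_mult_vec)

lemma coord_proj_fixes: "b \<in> carrier_vec p \<Longrightarrow> supp b \<subseteq> M \<Longrightarrow> coord_proj *\<^sub>v b = b"
  by (auto simp: coord_proj_vec supp_subset_iff intro!: eq_vecI)

lemma supp_coord_proj: "b \<in> carrier_vec p \<Longrightarrow> supp (coord_proj *\<^sub>v b) \<subseteq> M"
  by (auto simp: coord_proj_vec supp_def split: if_splits)

lemma coord_proj_idem: "coord_proj * coord_proj = coord_proj"
proof -
  have "coord_proj * coord_proj = mat_diag p (\<lambda>j. (if j \<in> M then 1 else 0) * (if j \<in> M then 1 else 0 :: real))"
    by (rule mat_diag_diag)
  also have "(\<lambda>j. (if j \<in> M then 1 else 0) * (if j \<in> M then 1 else 0 :: real)) = (\<lambda>j. if j \<in> M then 1 else 0)"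
    by auto
  finally show ?thesis .
qed

text \<open>The restricted Gram matrix \<open>gram\<close> is singular as soon as \<open>M\<close> omits a predictor, but
  \<open>gram + (1\<^sub>m p - coord_proj)\<close> acts as the identity on the omitted coordinates and
  injectively on the selected ones. Its inverse \<open>H\<close> inverts \<open>gram\<close> on the latter.\<close>

lemma ls_inverse_exists:
  obtains H where "H \<in> carrier_mat p p" "H * coord_proj = coord_proj * H" "gram * H = coord_proj" "H * gram = coord_proj"
proof -
  have Xd: "dim_row X = n" "dim_col X = p" using X by auto
  define S where "S = gram + (1\<^sub>m p - coord_proj)"
  have S: "S \<in> carrier_mat p p" by (auto simp: S_def)
  have DG: "coord_proj * gram = gram" and GD: "gram * coord_proj = gram"
    using coord_proj_idem by (simp_all add: mat_mult_assoc_dim Xd, simp add: mat_mult_assoc_dim[symmetric] Xd)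
  have Gc: "gram \<in> carrier_mat p p" by (rule carrier_matI) simp_all
  have Z: "1\<^sub>m p - coord_proj \<in> carrier_mat p p" by auto
  have DZ: "coord_proj * (1\<^sub>m p - coord_proj) = 0\<^sub>m p p" and ZD: "(1\<^sub>m p - coord_proj) * coord_proj = 0\<^sub>m p p"
    using coord_proj_idem coord_proj_carrier
    by (simp_all add: mult_minus_distrib_mat[OF coord_proj_carrier one_carrier_mat coord_proj_carrier]
        minus_mult_distrib_mat[OF one_carrier_mat coord_proj_carrier coord_proj_carrier])
  have DS: "coord_proj * S = gram" unfolding S_def
    using coord_proj_carrier Gc Z by (subst mult_add_distrib_mat[OF coord_proj_carrier Gc Z]) (auto simp: DG DZ)
  have SD: "S * coord_proj = gram" unfolding S_def
    using coord_proj_carrier Gc Z by (subst add_mult_distrib_mat[OF Gc Z coord_proj_carrier]) (auto simp: GD ZD)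
  have "det S \<noteq> 0"
  proof
    assume "det S = 0"
    then obtain v where v: "v \<in> carrier_vec p" "v \<noteq> 0\<^sub>v p" "S *\<^sub>v v = 0\<^sub>v p"
      using det_0_iff_vec_prod_zero_field[OF S] by auto
    have "gram *\<^sub>v v = coord_proj *\<^sub>v (S *\<^sub>v v)"
      unfolding DS[symmetric] using S v by (simp add: mat_vec_mult_assoc_dim)
    also have "\<dots> = 0\<^sub>v p" unfolding v(3) by (simp add: coord_proj_vec) (auto intro!: eq_vecI)
    finally have Gv: "gram *\<^sub>v v = 0\<^sub>v p" .
    have "S *\<^sub>v v = gram *\<^sub>v v + (v - coord_proj *\<^sub>v v)"
      unfolding S_def using v Gc Z coord_proj_carrier
      by (subst add_mult_distrib_mat_vec[OF Gc Z v(1)], subst minus_mult_distrib_mat_vec[OF one_carrier_mat coord_proj_carrier v(1)]) auto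
    then have e: "v - coord_proj *\<^sub>v v = 0\<^sub>v p"
      using v by (simp add: Gv coord_proj_vec)
    have Dv: "coord_proj *\<^sub>v v = v"
    proof (intro eq_vecI)
      fix i assume "i < dim_vec v"
      then show "(coord_proj *\<^sub>v v) $ i = v $ i"
        using arg_cong[OF e, of "\<lambda>u. u $ i"] v(1) by (simp del: index_mult_mat_vec)
    qed (use v in auto)
    have sv: "supp v \<subseteq> M" using supp_coord_proj[OF v(1)] by (simp add: Dv)
    have "sqnorm (X *\<^sub>v v) = (transpose_mat X *\<^sub>v (X *\<^sub>v v)) \<bullet> v"
      unfolding sqnorm_def using X v by (subst transpose_vec_mult_scalar[of X n p]) auto
    also have "\<dots> = (transpose_mat X *\<^sub>v (X *\<^sub>v v)) \<bullet> (coord_proj *\<^sub>v v)" by (simp add: Dv)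
    also have "\<dots> = (transpose_mat coord_proj *\<^sub>v (transpose_mat X *\<^sub>v (X *\<^sub>v v))) \<bullet> v"
      using X v by (intro transpose_vec_mult_scalar[OF coord_proj_carrier v(1), symmetric]) auto
    also have "transpose_mat coord_proj *\<^sub>v (transpose_mat X *\<^sub>v (X *\<^sub>v v)) = gram *\<^sub>v v"
    proof -
      have "gram *\<^sub>v v = coord_proj *\<^sub>v (transpose_mat X *\<^sub>v (X *\<^sub>v (coord_proj *\<^sub>v v)))"
        using X v by (simp add: mat_vec_mult_assoc_dim)
      then show ?thesis by (simp add: coord_proj_transpose Dv)
    qed
    finally have "sqnorm (X *\<^sub>v v) = 0" using v by (simp add: Gv)
    then have "X *\<^sub>v v = 0\<^sub>v n" using X v by (simp add: sqnorm_eq_0[of _ n])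
    then show False using indep sv v Xd unfolding indep_on_def by auto
  qed
  then have "S \<in> Units (ring_mat TYPE(real) p ())"
    by (rule det_non_zero_imp_unit[OF S])
  then obtain H where H: "H \<in> carrier_mat p p" "H * S = 1\<^sub>m p" "S * H = 1\<^sub>m p"
    unfolding Units_def ring_mat_def by auto
  have dims: "dim_row H = p" "dim_col H = p" "dim_row S = p" "dim_col S = p" using H S by auto
  have GH: "gram * H = coord_proj"
    unfolding DS[symmetric] using H dims by (simp add: mat_mult_assoc_dim)
  have HG: "H * gram = coord_proj"
    unfolding SD[symmetric] using H dims coord_proj_carrier
    by (subst mat_mult_assoc_dim[symmetric]) auto
  have "H * coord_proj = H * (gram * H)" unfolding GH ..
  also have "\<dots> = (H * gram) * H"
    by (rule mat_mult_assoc_dim[symmetric]) (simp_all add: dims)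
  also have "\<dots> = coord_proj * H" unfolding HG ..
  finally show thesis using that H(1) GH HG by blast
qed

text \<open>\<open>H * coord_proj\<close> satisfies the Moore--Penrose equations for the Gram matrix.\<close>

lemma ls_est_eq:
  obtains H where "H \<in> carrier_mat p p" "gram * H = coord_proj"
    "\<And>y. y \<in> carrier_vec n \<Longrightarrow> ls_est X M y = coord_proj *\<^sub>v (H *\<^sub>v (transpose_mat X *\<^sub>v y))"
proof -
  have Xd: "dim_row X = n" "dim_col X = p" using X by auto
  obtain H where H: "H \<in> carrier_mat p p" and com: "H * coord_proj = coord_proj * H" and GH: "gram * H = coord_proj" and HG: "H * gram = coord_proj"
    using ls_inverse_exists .
  have dims: "dim_row H = p" "dim_col H = p" using H by auto
  have GHD: "gram * (H * coord_proj) = coord_proj"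
    using GH dims Xd coord_proj_idem by (subst mat_mult_assoc_dim[symmetric]) auto
  have DG: "coord_proj * gram = gram"
    using coord_proj_idem by (simp add: mat_mult_assoc_dim Xd, simp add: mat_mult_assoc_dim[symmetric] Xd)
  have HDG: "(H * coord_proj) * gram = coord_proj"
    using HG dims Xd DG by (subst mat_mult_assoc_dim) auto
  have DDH: "coord_proj * (coord_proj * H) = coord_proj * H"
    by (subst mat_mult_assoc_dim[symmetric]) (simp_all only: coord_proj_dims dims coord_proj_idem)
  have "H * coord_proj \<in> carrier_mat p p" by (rule carrier_matI) (simp_all add: dims)
  then have "is_moore_penrose gram (H * coord_proj)"
    unfolding is_moore_penrose_def GHD HDG
    by (simp add: coord_proj_transpose DG DDH com)
  then have pinv: "pinv gram = H * coord_proj" by (rule pinv_eqI)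
  have "ls_est X M y = coord_proj *\<^sub>v (H *\<^sub>v (transpose_mat X *\<^sub>v y))" if y: "y \<in> carrier_vec n" for y
  proof -
    have "ls_est X M y = (H * coord_proj * coord_proj * transpose_mat X) *\<^sub>v y"
      unfolding ls_est_def Xd Let_def pinv ..
    also have "H * coord_proj * coord_proj = H * (coord_proj * coord_proj)"
      by (rule mat_mult_assoc_dim) (simp_all add: dims)
    also have "\<dots> = coord_proj * H" unfolding coord_proj_idem com ..
    also have "(coord_proj * H * transpose_mat X) *\<^sub>v y = coord_proj *\<^sub>v (H *\<^sub>v (transpose_mat X *\<^sub>v y))"
      using dims Xd y by (simp add: mat_vec_mult_assoc_dim)
    finally show ?thesis .
  qed
  then show thesis using that H GH by blast
qed

lemma ls_est_carrier: "y \<in> carrier_vec n \<Longrightarrow> ls_est X M y \<in> carrier_vec p"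
  and supp_ls_est: "y \<in> carrier_vec n \<Longrightarrow> supp (ls_est X M y) \<subseteq> M"
proof -
  obtain H where H: "H \<in> carrier_mat p p"
    "\<And>y. y \<in> carrier_vec n \<Longrightarrow> ls_est X M y = coord_proj *\<^sub>v (H *\<^sub>v (transpose_mat X *\<^sub>v y))"
    using ls_est_eq by metis
  assume y: "y \<in> carrier_vec n"
  have "H *\<^sub>v (transpose_mat X *\<^sub>v y) \<in> carrier_vec p" using H(1) by auto
  then show "ls_est X M y \<in> carrier_vec p" "supp (ls_est X M y) \<subseteq> M"
    using H(2)[OF y] supp_coord_proj coord_proj_carrier by auto
qed

lemma ls_est_normal_eq:
  assumes y: "y \<in> carrier_vec n" and b: "b \<in> carrier_vec p" "supp b \<subseteq> M"
  shows "(X *\<^sub>v ls_est X M y) \<bullet> (X *\<^sub>v b) = y \<bullet> (X *\<^sub>v b)"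
proof -
  have Xd: "dim_row X = n" "dim_col X = p" using X by auto
  obtain H where H: "H \<in> carrier_mat p p" and GH: "gram * H = coord_proj"
    and ls: "\<And>y. y \<in> carrier_vec n \<Longrightarrow> ls_est X M y = coord_proj *\<^sub>v (H *\<^sub>v (transpose_mat X *\<^sub>v y))"
    using ls_est_eq by metis
  have dims: "dim_row H = p" "dim_col H = p" using H by auto
  define z where "z = transpose_mat X *\<^sub>v y"
  have z: "z \<in> carrier_vec p" using Xd by (simp add: z_def)
  have adj: "(X *\<^sub>v u) \<bullet> (X *\<^sub>v b) = (coord_proj *\<^sub>v (transpose_mat X *\<^sub>v (X *\<^sub>v u))) \<bullet> b" if "u \<in> carrier_vec p" for u
  proof -
    have "(X *\<^sub>v u) \<bullet> (X *\<^sub>v b) = (transpose_mat X *\<^sub>v (X *\<^sub>v u)) \<bullet> b"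
      using X that b by (intro transpose_vec_mult_scalar[symmetric]) auto
    also have "\<dots> = (transpose_mat X *\<^sub>v (X *\<^sub>v u)) \<bullet> (coord_proj *\<^sub>v b)" by (simp add: coord_proj_fixes b)
    also have "\<dots> = (transpose_mat coord_proj *\<^sub>v (transpose_mat X *\<^sub>v (X *\<^sub>v u))) \<bullet> b"
      using X b by (intro transpose_vec_mult_scalar[OF coord_proj_carrier, symmetric]) auto
    finally show ?thesis by (simp add: coord_proj_transpose)
  qed
  have "coord_proj *\<^sub>v (transpose_mat X *\<^sub>v (X *\<^sub>v ls_est X M y)) = (gram * H) *\<^sub>v z"
    unfolding ls[OF y] z_def using Xd dims y by (simp add: mat_vec_mult_assoc_dim)
  also have "\<dots> = coord_proj *\<^sub>v z" by (simp add: GH)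
  finally have "(X *\<^sub>v ls_est X M y) \<bullet> (X *\<^sub>v b) = (coord_proj *\<^sub>v z) \<bullet> b"
    using adj[OF ls_est_carrier[OF y]] by simp
  also have "\<dots> = (transpose_mat coord_proj *\<^sub>v z) \<bullet> b" by (simp add: coord_proj_transpose)
  also have "\<dots> = z \<bullet> (coord_proj *\<^sub>v b)"
    by (rule transpose_vec_mult_scalar[OF coord_proj_carrier b(1) z])
  also have "\<dots> = z \<bullet> b" by (simp add: coord_proj_fixes b)
  also have "\<dots> = y \<bullet> (X *\<^sub>v b)"
    unfolding z_def using X b y by (intro transpose_vec_mult_scalar) auto
  finally show ?thesis .
qed

lemma ls_est_optimal:
  assumes y: "y \<in> carrier_vec n" and b: "b \<in> carrier_vec p" "supp b \<subseteq> M"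
  shows "sqnorm (y - X *\<^sub>v ls_est X M y) \<le> sqnorm (y - X *\<^sub>v b)"
proof -
  define m where "m = X *\<^sub>v ls_est X M y"
  define z where "z = X *\<^sub>v b"
  have m: "m \<in> carrier_vec n" and z: "z \<in> carrier_vec n" using X by (auto simp: m_def z_def)
  have 1: "m \<bullet> z = y \<bullet> z" unfolding m_def z_def by (rule ls_est_normal_eq[OF y b])
  have 2: "m \<bullet> m = y \<bullet> m"
    unfolding m_def by (rule ls_est_normal_eq[OF y ls_est_carrier[OF y] supp_ls_est[OF y]])
  have "sqnorm (y - z) = sqnorm (y - m) + sqnorm (m - z)"
    unfolding sqnorm_minus[OF y z] sqnorm_minus[OF y m] sqnorm_minus[OF m z]
    using 1 2 by (simp add: sqnorm_def)
  then show ?thesis using sqnorm_nonneg[of "m - z"] by (simp add: m_def z_def)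
qed

lemma measurable_ls_est: "(\<lambda>y. ls_est X M y) \<in> measurable (vec_borel n) (vec_borel p)"
proof -
  have Xd: "dim_row X = n" "dim_col X = p" using X by auto
  obtain H where H: "H \<in> carrier_mat p p"
    and ls: "\<And>y. y \<in> carrier_vec n \<Longrightarrow> ls_est X M y = coord_proj *\<^sub>v (H *\<^sub>v (transpose_mat X *\<^sub>v y))"
    using ls_est_eq by metis
  have "(\<lambda>y. coord_proj *\<^sub>v (H *\<^sub>v (transpose_mat X *\<^sub>v y))) \<in> measurable (vec_borel n) (vec_borel p)"
    using X H
    by (intro measurable_mult_mat_vec[OF coord_proj_carrier] measurable_mult_mat_vec[OF H]
        measurable_mult_mat_vec[of _ p n] measurable_ident) auto
  then show ?thesis
    by (rule measurable_cong[THEN iffD1, rotated]) (simp add: ls)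
qed

end


section \<open>An oracle inequality for penalized least squares\<close>

text \<open>The basic inequality of penalized least squares. Comparing the criterion at \<open>M\<close> with its
  value at \<open>M0\<close>, where the residual is at most the noise, bounds the loss by
  \<open>2 * (e \<bullet> w) + q0 - q\<close> with \<open>w\<close> the estimation error. As \<open>w\<close> lies in the span
  of \<open>M \<union> M0\<close>, only the projection of the noise to that span counts, and
  \<open>2 * (z \<bullet> c) \<le> \<theta> * sqnorm c + sqnorm z / \<theta>\<close> absorbs the rest into the loss.\<close>

lemma penalized_ls_pathwise:
  assumes X: "X \<in> carrier_mat n p" and e: "e \<in> carrier_vec n"
    and b: "b \<in> carrier_vec p" "supp b \<subseteq> M0"
    and ind: "indep_on X M" "indep_on X M0"
    and U: "U \<in> carrier_mat n d" "transpose_mat U * U = 1\<^sub>m d"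
    and span: "model_space X (M \<union> M0) = {U *\<^sub>v c |c. c \<in> carrier_vec d}"
    and opt: "sqnorm (X *\<^sub>v b + e - X *\<^sub>v ls_est X M (X *\<^sub>v b + e)) + q
      \<le> sqnorm (X *\<^sub>v b + e - X *\<^sub>v ls_est X M0 (X *\<^sub>v b + e)) + q0"
    and \<theta>: "0 < \<theta>"
  shows "(1 - \<theta>) * sqnorm (X *\<^sub>v ls_est X M (X *\<^sub>v b + e) - X *\<^sub>v b)
    \<le> sqnorm (transpose_mat U *\<^sub>v e) / \<theta> + q0 - q"
proof -
  define m where "m = X *\<^sub>v b"
  define y where "y = m + e"
  define h where "h = X *\<^sub>v ls_est X M y"
  have m: "m \<in> carrier_vec n" using X by (simp add: m_def)
  have y: "y \<in> carrier_vec n" using m e by (simp add: y_def)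
  have h: "h \<in> carrier_vec n" using X by (simp add: h_def)
  have ym: "y - m = e" using m e by (intro eq_vecI) (auto simp: y_def)
  have yh: "y - h = e - (h - m)" using m e h by (intro eq_vecI) (auto simp: y_def)
  have "h - m \<in> model_space X (M \<union> M0)"
    unfolding h_def m_def
    by (intro model_space_diff[OF X] model_spaceI[OF X] ls_est_carrier[OF X ind(1) y]
        supp_ls_est[OF X ind(1) y] b)
  then obtain c where c: "c \<in> carrier_vec d" and w: "h - m = U *\<^sub>v c"
    unfolding span by blast
  define z where "z = transpose_mat U *\<^sub>v e"
  have z: "z \<in> carrier_vec d" using U(1) by (simp add: z_def)
  have nw: "sqnorm (h - m) = sqnorm c"
    unfolding w by (rule sqnorm_orthonormal_frame[OF U c])
  have ew: "e \<bullet> (h - m) = z \<bullet> c"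
    unfolding w z_def by (rule transpose_vec_mult_scalar[OF U(1) c e, symmetric])
  have "sqnorm (y - X *\<^sub>v ls_est X M0 y) \<le> sqnorm e"
    using ls_est_optimal[OF X ind(2) y b] by (simp add: m_def[symmetric] ym)
  moreover have "sqnorm (y - h) + q \<le> sqnorm (y - X *\<^sub>v ls_est X M0 y) + q0"
    using opt by (simp add: h_def y_def m_def)
  ultimately have "sqnorm (y - h) + q \<le> sqnorm e + q0" by linarith
  moreover have "sqnorm (y - h) = sqnorm e - 2 * (z \<bullet> c) + sqnorm c"
    unfolding yh using h m by (subst sqnorm_minus[OF e]) (auto simp: ew nw)
  ultimately have 1: "sqnorm c \<le> 2 * (z \<bullet> c) + q0 - q" by linarith
  have "0 \<le> sqnorm (\<theta> \<cdot>\<^sub>v c - z)" by simp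
  also have "\<dots> = \<theta>\<^sup>2 * sqnorm c - 2 * (\<theta> * (z \<bullet> c)) + sqnorm z"
    using c z by (subst sqnorm_minus[of _ d]) (auto simp: sqnorm_smult comm_scalar_prod[of z d c])
  finally have "\<theta> * (2 * (z \<bullet> c)) \<le> \<theta>\<^sup>2 * sqnorm c + sqnorm z"
    by (simp add: algebra_simps)
  also have "\<dots> = \<theta> * (\<theta> * sqnorm c + sqnorm z / \<theta>)"
    using \<theta> by (simp add: field_simps power2_eq_square)
  finally have "\<theta> * (2 * (z \<bullet> c)) \<le> \<theta> * (\<theta> * sqnorm c + sqnorm z / \<theta>)" .
  then have "2 * (z \<bullet> c) \<le> \<theta> * sqnorm c + sqnorm z / \<theta>"
    using \<theta> by (simp only: mult_le_cancel_left_pos)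
  with 1 have "(1 - \<theta>) * sqnorm c \<le> sqnorm z / \<theta> + q0 - q" by (simp add: algebra_simps)
  then show ?thesis unfolding z_def nw[symmetric] h_def y_def m_def .
qed

text \<open>One member of the sequence of regression models. The positive sparse eigenvalue ratio makes
  least squares well posed in every admissible model.\<close>

locale sparse_design =
  fixes X :: "real mat" and n p r :: nat and A :: "nat set set"
  assumes X: "X \<in> carrier_mat n p"
    and tau_pos: "tau X r > 0"
    and admissible: "admissible_class p r A"

lemma (in sparse_design) admissibleD:
  assumes "M \<in> A"
  shows "M \<subseteq> {..<p}" "card M \<le> r" "finite M" "indep_on X M"
proof -
  show 1: "M \<subseteq> {..<p}" and 2: "card M \<le> r"
    using assms admissible by (auto simp: admissible_class_def)
  show 3: "finite M" using 1 by (rule finite_subset) simp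
  show "indep_on X M" using tau_pos 3 2 by (rule indep_on_if_tau_pos)
qed

lemma (in sparse_design) finite_admissible: "finite A"
  using admissibleD(1) by (intro finite_subset[of A "Pow {..<p}"]) auto

lemma (in sparse_design) null_admissible: "{} \<in> A"
  using admissible by (simp add: admissible_class_def)

lemma (in sparse_design) num_models_0: "num_models A 0 = 1"
proof -
  have "models_of_size A 0 = {{}}"
    using null_admissible admissibleD(3) by (auto simp: models_of_size_def)
  then show ?thesis by (simp add: num_models_def)
qed

lemma (in sparse_design) num_models_r: "num_models A r = 1"
  using admissible by (simp add: admissible_class_def)

lemma (in sparse_design) num_models_pos: "M \<in> A \<Longrightarrow> num_models A (card M) > 0"
  using finite_admissible by (auto simp: num_models_def models_of_size_def card_gt_0_iff)

lemma (in sparse_design) sum_over_sizes: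
  "(\<Sum>M\<in>A. f (card M)) = (\<Sum>k\<le>r. real (num_models A k) * f k)"
proof -
  have "(\<Sum>M\<in>A. f (card M)) = (\<Sum>k\<le>r. \<Sum>M\<in>{M \<in> A. card M = k}. f (card M))"
    using finite_admissible admissibleD(2) by (intro sum.group[symmetric]) auto
  also have "\<dots> = (\<Sum>k\<le>r. real (num_models A k) * f k)"
    by (intro sum.cong) (auto simp: num_models_def models_of_size_def)
  finally show ?thesis .
qed

lemma (in sparse_design) dim_X [simp]: "dim_row X = n" "dim_col X = p"
  using X by auto

text \<open>The oracle inequality. The selected model is random, so the chi-square variable in the
  pathwise inequality has to be compensated by the penalty simultaneously for all models. With
  \<open>\<kappa> = t * \<theta> / (2 * \<sigma>\<^sup>2)\<close>, each excess \<open>x\<close> over the penalty satisfies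
  \<open>x \<le> exp (\<kappa> * x) / \<kappa>\<close>, the selected term is at most the sum over all
  models, and each summand is integrated with the chi-square moment generating function. The
  hypothesis on \<open>S\<close> is the resulting summability condition on the penalty.\<close>

lemma (in sparse_design) map_est_risk_le:
  assumes \<sigma>: "\<sigma> > 0" and t: "0 < t" "t < 1" and \<theta>: "0 < \<theta>" "\<theta> < 1"
    and Mhat: "\<And>y. y \<in> carrier_vec n \<Longrightarrow> Mhat y \<in> A"
    and opt: "\<And>y M. y \<in> carrier_vec n \<Longrightarrow> M \<in> A \<Longrightarrow>
      sqnorm (y - X *\<^sub>v ls_est X (Mhat y) y) + pen (Mhat y) \<le> sqnorm (y - X *\<^sub>v ls_est X M y) + pen M"
    and S: "(\<Sum>M\<in>A. exp (- (t * \<theta> / (2 * \<sigma>\<^sup>2)) * pen M) * (1 - t) powr (- real (card M) / 2)) \<le> S"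
    and M0: "M0 \<in> A" "pen M0 \<ge> 0" and b: "b \<in> carrier_vec p" "supp b \<subseteq> M0"
  shows "risk \<sigma> X (map_est X Mhat) b \<le> ennreal (1 / (1 - \<theta>) *
    (pen M0 + 2 * \<sigma>\<^sup>2 / (t * \<theta>) * (real (card M0) / 2 * ln (1 / (1 - t)) + S)))"
proof -
  define k0 where "k0 = card M0"
  define \<kappa> where "\<kappa> = t * \<theta> / (2 * \<sigma>\<^sup>2)"
  define B where "B = 1 / \<kappa> * (real k0 / 2 * ln (1 / (1 - t)))"
  have \<kappa>: "\<kappa> > 0" using \<sigma> t \<theta> by (simp add: \<kappa>_def)
  have B: "B \<ge> 0" using \<kappa> t by (simp add: B_def)
  have "\<forall>M\<in>A. \<exists>U. \<exists>d\<le>card (M \<union> M0). U \<in> carrier_mat n d \<and> transpose_mat U * U = 1\<^sub>m d \<and>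
      model_space X (M \<union> M0) = {U *\<^sub>v c |c. c \<in> carrier_vec d}"
  proof
    fix M assume "M \<in> A"
    then have "finite (M \<union> M0)" "M \<union> M0 \<subseteq> {..<p}"
      using M0 admissibleD by auto
    from orthonormal_frame_exists[OF X this] obtain d U where
      "d \<le> card (M \<union> M0)" "U \<in> carrier_mat n d" "transpose_mat U * U = 1\<^sub>m d"
      "model_space X (M \<union> M0) = {U *\<^sub>v c |c. c \<in> carrier_vec d}"
      by (elim exE conjE bexE)
    then show "\<exists>U. \<exists>d\<le>card (M \<union> M0). U \<in> carrier_mat n d \<and> transpose_mat U * U = 1\<^sub>m d \<and>
      model_space X (M \<union> M0) = {U *\<^sub>v c |c. c \<in> carrier_vec d}"
      by (intro exI[of _ U] exI[of _ d] conjI)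
  qed
  from bchoice[OF this] obtain U where "\<forall>M\<in>A. \<exists>d\<le>card (M \<union> M0). U M \<in> carrier_mat n d \<and>
      transpose_mat (U M) * U M = 1\<^sub>m d \<and> model_space X (M \<union> M0) = {U M *\<^sub>v c |c. c \<in> carrier_vec d}"
    by auto
  from bchoice[OF this] obtain d where
    d: "\<And>M. M \<in> A \<Longrightarrow> d M \<le> card (M \<union> M0)" and
    U: "\<And>M. M \<in> A \<Longrightarrow> U M \<in> carrier_mat n (d M)" "\<And>M. M \<in> A \<Longrightarrow> transpose_mat (U M) * U M = 1\<^sub>m (d M)"
      "\<And>M. M \<in> A \<Longrightarrow> model_space X (M \<union> M0) = {U M *\<^sub>v c |c. c \<in> carrier_vec (d M)}"
    by auto
  have dle: "d M \<le> card M + k0" if "M \<in> A" for M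
    using d[OF that] card_Un_le[of M M0] by (simp add: k0_def)
  define w where "w = (\<lambda>M. exp (- \<kappa> * pen M) * (1 - t) powr (real k0 / 2))"
  define E where "E = (\<lambda>M e. exp (t / (2 * \<sigma>\<^sup>2) * sqnorm (transpose_mat (U M) *\<^sub>v e)))"
  define F where "F = (\<lambda>e. 1 / (1 - \<theta>) * (pen M0 + B + 1 / \<kappa> * (\<Sum>M\<in>A. w M * E M e)))"
  have pointwise: "sqnorm (map_est X Mhat (X *\<^sub>v b + e) - X *\<^sub>v b) \<le> F e" if e: "e \<in> carrier_vec n" for e
  proof -
    define y where "y = X *\<^sub>v b + e"
    have y: "y \<in> carrier_vec n" using e by (simp add: y_def)
    define M where "M = Mhat y"
    have MA: "M \<in> A" using Mhat[OF y] by (simp add: M_def)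
    define Z where "Z = sqnorm (transpose_mat (U M) *\<^sub>v e)"
    have "(1 - \<theta>) * sqnorm (X *\<^sub>v ls_est X M (X *\<^sub>v b + e) - X *\<^sub>v b) \<le> Z / \<theta> + pen M0 - pen M"
      unfolding Z_def
      using opt[OF y M0(1)]
      by (intro penalized_ls_pathwise[OF X e b admissibleD(4)[OF MA] admissibleD(4)[OF M0(1)] U(1-3)[OF MA] _ \<theta>(1)])
        (simp add: M_def y_def)
    \<comment> \<open>\<open>B\<close> cancels the contribution of \<open>M0\<close> to the degrees of freedom of \<open>Z\<close>.\<close>
    also have "Z / \<theta> + pen M0 - pen M = pen M0 + B + (Z / \<theta> - pen M - B)" by simp
    also have "Z / \<theta> - pen M - B \<le> 1 / \<kappa> * exp (\<kappa> * (Z / \<theta> - pen M - B))"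
      using \<kappa> exp_ge_add_one_self[of "\<kappa> * (Z / \<theta> - pen M - B)"]
      by (simp add: field_simps)
    also have "exp (\<kappa> * (Z / \<theta> - pen M - B)) = w M * E M e"
    proof -
      have "\<kappa> * (Z / \<theta>) = t / (2 * \<sigma>\<^sup>2) * Z" using \<theta> by (simp add: \<kappa>_def)
      moreover have "\<kappa> * B = - (real k0 / 2 * ln (1 - t))"
        using \<kappa> t by (simp add: B_def ln_div)
      ultimately have "\<kappa> * (Z / \<theta> - pen M - B) = - \<kappa> * pen M + real k0 / 2 * ln (1 - t) + t / (2 * \<sigma>\<^sup>2) * Z"
        by (simp add: right_diff_distrib)
      then show ?thesis
        using t unfolding w_def E_def Z_def by (simp only: exp_add powr_def) simp
    qed
    also have "w M * E M e \<le> (\<Sum>M\<in>A. w M * E M e)"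
      using finite_admissible MA by (intro member_le_sum) (auto simp: w_def E_def)
    finally have "(1 - \<theta>) * sqnorm (X *\<^sub>v ls_est X M (X *\<^sub>v b + e) - X *\<^sub>v b)
        \<le> pen M0 + B + 1 / \<kappa> * (\<Sum>M\<in>A. w M * E M e)"
      using \<kappa> by (simp add: divide_right_mono)
    then show ?thesis
      using \<theta> unfolding F_def map_est_def M_def y_def by (simp add: field_simps)
  qed
  have Em: "(\<lambda>e. ennreal (E M e)) \<in> borel_measurable (vec_borel n)" if "M \<in> A" for M
  proof -
    have "transpose_mat (U M) \<in> carrier_mat (d M) n" using U(1)[OF that] by simp
    from measurable_mult_mat_vec[OF this measurable_ident[unfolded id_def]]
    have "(\<lambda>e. sqnorm (transpose_mat (U M) *\<^sub>v e)) \<in> borel_measurable (vec_borel n)"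
      by (rule measurable_sqnorm)
    then show ?thesis unfolding E_def by measurable
  qed
  have Eint: "(\<integral>\<^sup>+ e. ennreal (E M e) \<partial>gauss_noise n \<sigma>) \<le> ennreal ((1 - t) powr (- real (card M + k0) / 2))"
    if "M \<in> A" for M
  proof -
    have "(\<integral>\<^sup>+ e. ennreal (E M e) \<partial>gauss_noise n \<sigma>) = ennreal ((1 - t) powr (- real (d M) / 2))"
      unfolding E_def using \<sigma> t U[OF that] by (intro gauss_noise_chi_square_mgf) auto
    also have "\<dots> \<le> ennreal ((1 - t) powr (- real (card M + k0) / 2))"
      using t dle[OF that] by (intro ennreal_leI powr_mono') auto
    finally show ?thesis .
  qed
  define c where "c = 1 / (1 - \<theta>)"
  have c: "c > 0" using \<theta> by (simp add: c_def)
  define v where "v = (\<lambda>M. c / \<kappa> * w M)"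
  have v: "v M \<ge> 0" for M using c \<kappa> by (simp add: v_def w_def)
  have Fsplit: "ennreal (F e) = ennreal (c * (pen M0 + B)) + (\<Sum>M\<in>A. ennreal (v M) * ennreal (E M e))" for e
  proof -
    have nn: "E M e \<ge> 0" for M by (simp add: E_def)
    have "F e = c * (pen M0 + B) + (\<Sum>M\<in>A. v M * E M e)"
      unfolding F_def c_def[symmetric] v_def by (simp add: distrib_left sum_distrib_left mult.assoc)
    moreover have "ennreal (c * (pen M0 + B) + (\<Sum>M\<in>A. v M * E M e)) =
        ennreal (c * (pen M0 + B)) + ennreal (\<Sum>M\<in>A. v M * E M e)"
      using M0(2) B c nn v by (intro ennreal_plus sum_nonneg mult_nonneg_nonneg) auto
    moreover have "ennreal (\<Sum>M\<in>A. v M * E M e) = (\<Sum>M\<in>A. ennreal (v M) * ennreal (E M e))"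
      using nn v by (simp add: sum_ennreal[symmetric] ennreal_mult)
    ultimately show ?thesis by (simp only:)
  qed
  interpret prob_space "gauss_noise n \<sigma>" using \<sigma> by (rule prob_space_gauss_noise)
  have "risk \<sigma> X (map_est X Mhat) b \<le> (\<integral>\<^sup>+ e. ennreal (F e) \<partial>gauss_noise n \<sigma>)"
    unfolding risk_def dim_X using pointwise
    by (intro nn_integral_mono ennreal_leI) simp
  also have "\<dots> = ennreal (c * (pen M0 + B)) + (\<Sum>M\<in>A. ennreal (v M) * (\<integral>\<^sup>+ e. ennreal (E M e) \<partial>gauss_noise n \<sigma>))"
    unfolding Fsplit using Em
    by (simp add: nn_integral_add nn_integral_sum nn_integral_cmult emeasure_space_1[unfolded space_gauss_noise])
  also have "\<dots> \<le> ennreal (c * (pen M0 + B)) + (\<Sum>M\<in>A. ennreal (v M) * ennreal ((1 - t) powr (- real (card M + k0) / 2)))"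
    using Eint by (intro add_left_mono sum_mono mult_left_mono) auto
  also have "(\<Sum>M\<in>A. ennreal (v M) * ennreal ((1 - t) powr (- real (card M + k0) / 2)))
     = ennreal (\<Sum>M\<in>A. c / \<kappa> * (exp (- \<kappa> * pen M) * (1 - t) powr (- real (card M) / 2)))"
  proof -
    have "(\<Sum>M\<in>A. ennreal (v M) * ennreal ((1 - t) powr (- real (card M + k0) / 2)))
      = (\<Sum>M\<in>A. ennreal (c / \<kappa> * (exp (- \<kappa> * pen M) * (1 - t) powr (- real (card M) / 2))))"
    proof (intro sum.cong refl)
      fix M :: "nat set"
      have "(1 - t) powr (real k0 / 2) * (1 - t) powr (- real (card M + k0) / 2) = (1 - t) powr (- real (card M) / 2)"
        by (simp add: powr_add[symmetric] field_simps)
      then have "v M * (1 - t) powr (- real (card M + k0) / 2) =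
          c / \<kappa> * (exp (- \<kappa> * pen M) * (1 - t) powr (- real (card M) / 2))"
        unfolding v_def w_def by (simp only: mult.assoc)
      then show "ennreal (v M) * ennreal ((1 - t) powr (- real (card M + k0) / 2)) =
          ennreal (c / \<kappa> * (exp (- \<kappa> * pen M) * (1 - t) powr (- real (card M) / 2)))"
        by (simp only: ennreal_mult[OF v powr_ge_zero, symmetric])
    qed
    also have "\<dots> = ennreal (\<Sum>M\<in>A. c / \<kappa> * (exp (- \<kappa> * pen M) * (1 - t) powr (- real (card M) / 2)))"
      using c \<kappa> by (intro sum_ennreal) simp
    finally show ?thesis .
  qed
  also have "ennreal (c * (pen M0 + B)) + ennreal (\<Sum>M\<in>A. c / \<kappa> * (exp (- \<kappa> * pen M) * (1 - t) powr (- real (card M) / 2)))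
      \<le> ennreal (c * (pen M0 + B)) + ennreal (c / \<kappa> * S)"
  proof (intro add_left_mono ennreal_leI)
    show "(\<Sum>M\<in>A. c / \<kappa> * (exp (- \<kappa> * pen M) * (1 - t) powr (- real (card M) / 2))) \<le> c / \<kappa> * S"
      using S c \<kappa> unfolding sum_distrib_left[symmetric] \<kappa>_def[symmetric]
      by (intro mult_left_mono) auto
  qed
  also have "ennreal (c * (pen M0 + B)) + ennreal (c / \<kappa> * S) = ennreal (c * (pen M0 + B) + c / \<kappa> * S)"
  proof -
    have "0 \<le> (\<Sum>M\<in>A. exp (- (t * \<theta> / (2 * \<sigma>\<^sup>2)) * pen M) * (1 - t) powr (- real (card M) / 2))"
      by (intro sum_nonneg) auto
    with S have "S \<ge> 0" by linarith
    then show ?thesis using M0(2) B c \<kappa> by (intro ennreal_plus[symmetric]) auto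
  qed
  finally have "risk \<sigma> X (map_est X Mhat) b \<le> ennreal (c * (pen M0 + B) + c / \<kappa> * S)" .
  moreover have "c * (pen M0 + B) + c / \<kappa> * S = 1 / (1 - \<theta>) *
    (pen M0 + 2 * \<sigma>\<^sup>2 / (t * \<theta>) * (real (card M0) / 2 * ln (1 / (1 - t)) + S))"
  proof -
    have "1 / \<kappa> = 2 * \<sigma>\<^sup>2 / (t * \<theta>)" by (simp add: \<kappa>_def)
    moreover have "c * (pen M0 + B) + c / \<kappa> * S = c * (pen M0 + 1 / \<kappa> * (real k0 / 2 * ln (1 / (1 - t)) + S))"
      by (simp add: B_def algebra_simps)
    ultimately show ?thesis by (simp only: c_def k0_def)
  qed
  ultimately show ?thesis by (simp only:)
qed

text \<open>Ties are broken by an enumeration of the finite set.\<close>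

lemma measurable_arg_min_selection:
  fixes f :: "'b \<Rightarrow> 'a \<Rightarrow> real"
  assumes A: "finite A" "A \<noteq> {}" and f: "\<And>a. a \<in> A \<Longrightarrow> (\<lambda>y. f y a) \<in> borel_measurable N"
  obtains g where "g \<in> measurable N (count_space A)" "\<And>y. g y \<in> A" "\<And>y a. a \<in> A \<Longrightarrow> f y (g y) \<le> f y a"
proof -
  obtain h where h: "bij_betw h {0..<card A} A" using ex_bij_betw_nat_finite[OF A(1)] by auto
  have hA: "h i \<in> A" if "i < card A" for i using h that by (auto simp: bij_betw_def)
  define P where "P = (\<lambda>i y. i < card A \<and> (\<forall>j\<in>{0..<card A}. f y (h i) \<le> f y (h j)))"
  define g where "g = (\<lambda>y. h (LEAST i. P i y))"
  have ex: "\<exists>i. P i y" for y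
  proof -
    obtain a where a: "a \<in> A" "\<forall>x\<in>A. f y a \<le> f y x"
      using finite_has_minimal[of "f y ` A"] A by (metis arg_min_if_finite linorder_not_le)
    then have "a \<in> h ` {0..<card A}" using bij_betw_imp_surj_on[OF h] by simp
    then obtain i where "i < card A" "h i = a" by auto
    then show ?thesis using a hA unfolding P_def by (intro exI[of _ i]) auto
  qed
  have gP: "P (LEAST i. P i y) y" for y using LeastI_ex[OF ex] .
  have gA: "g y \<in> A" for y using gP[of y] hA by (auto simp: P_def g_def)
  have gmin: "f y (g y) \<le> f y a" if "a \<in> A" for y a
  proof -
    have "a \<in> h ` {0..<card A}" using that bij_betw_imp_surj_on[OF h] by simp
    then obtain j where "j < card A" "h j = a" by auto
    then show ?thesis using gP[of y] by (auto simp: P_def g_def)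
  qed
  have "Measurable.pred N (P i)" for i
  proof (cases "i < card A")
    case True
    have "{y \<in> space N. f y (h i) \<le> f y (h j)} \<in> sets N" if "j \<in> {0..<card A}" for j
      using f[OF hA[OF True]] f[OF hA[of j]] that by (intro borel_measurable_le) auto
    then have "{y \<in> space N. \<forall>j\<in>{0..<card A}. f y (h i) \<le> f y (h j)} \<in> sets N"
      by (intro sets.sets_Collect_finite_All) auto
    then show ?thesis using True by (simp add: P_def pred_def)
  next
    case False
    then show ?thesis by (simp add: P_def)
  qed
  then have least: "(\<lambda>y. LEAST i. P i y) \<in> measurable N (count_space UNIV)"
    by (rule measurable_Least)
  have "g \<in> measurable N (count_space UNIV)"
    unfolding g_def using measurable_compose[OF least, of h "count_space UNIV"] by simp
  then have "g \<in> measurable N (count_space A)"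
    using gA by (auto simp: measurable_def intro!: measurable_sets)
  then show thesis using that gA gmin by blast
qed


section \<open>Lower bound for the minimax risk\<close>

lemma bessel:
  assumes U: "U \<in> carrier_mat n d" "transpose_mat U * U = 1\<^sub>m d" and w: "w \<in> carrier_vec n"
  shows "sqnorm (transpose_mat U *\<^sub>v w) \<le> sqnorm w"
proof -
  define z where "z = transpose_mat U *\<^sub>v w"
  have z: "z \<in> carrier_vec d" using U(1) by (simp add: z_def)
  have Uz: "U *\<^sub>v z \<in> carrier_vec n" using U(1) by simp
  have "w \<bullet> (U *\<^sub>v z) = z \<bullet> z"
    unfolding z_def using U(1) w z by (intro transpose_vec_mult_scalar[symmetric]) (auto simp: z_def)
  then have "sqnorm (w - U *\<^sub>v z) = sqnorm w - sqnorm z"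
    using sqnorm_minus[OF w Uz] sqnorm_orthonormal_frame[OF U z] by (simp add: sqnorm_def)
  then show ?thesis using sqnorm_nonneg[of "w - U *\<^sub>v z"] by (simp add: z_def)
qed

text \<open>With \<open>L\<close> the likelihood ratio of two Gaussian laws whose means differ by \<open>v\<close>, the
  integral is their overlap. It follows from \<open>L - L\<^sup>2 / 4 \<le> min 1 L\<close> and the
  first two moments of \<open>L\<close>, which are 1 and \<open>exp 1 \<le> 3\<close> at distance \<open>\<sigma>\<close>.\<close>

lemma gauss_noise_overlap:
  assumes \<sigma>: "\<sigma> > 0" and v: "v \<in> carrier_vec n" "sqnorm v = \<sigma>\<^sup>2"
  shows "ennreal (1 / 4) \<le> (\<integral>\<^sup>+ e. ennreal (min 1 (exp ((v \<bullet> e - sqnorm v / 2) / \<sigma>\<^sup>2))) \<partial>gauss_noise n \<sigma>)"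
proof -
  define L where "L = (\<lambda>e. exp ((v \<bullet> e - sqnorm v / 2) / \<sigma>\<^sup>2))"
  define I where "I = (\<integral>\<^sup>+ e. ennreal (min 1 (L e)) \<partial>gauss_noise n \<sigma>)"
  interpret prob_space "gauss_noise n \<sigma>" using \<sigma> by (rule prob_space_gauss_noise)
  have vm [measurable]: "(\<lambda>e. v \<bullet> e) \<in> borel_measurable (vec_borel n)"
    using v by (intro measurable_scalar_prod measurable_const measurable_ident) auto
  have Lm [measurable]: "L \<in> borel_measurable (vec_borel n)" unfolding L_def by measurable
  have mass: "(\<integral>\<^sup>+ e. ennreal (L e) \<partial>gauss_noise n \<sigma>) = 1"
    using gauss_noise_shift[OF \<sigma> v(1), of "\<lambda>_. 1"] emeasure_space_1 by (simp add: L_def)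
  have second_moment: "(\<integral>\<^sup>+ e. ennreal ((L e)\<^sup>2) \<partial>gauss_noise n \<sigma>) = ennreal (exp 1)"
  proof -
    have "(L e)\<^sup>2 = exp (- 1) * exp (((2 / \<sigma>\<^sup>2) \<cdot>\<^sub>v v) \<bullet> e)" if "e \<in> carrier_vec n" for e
    proof -
      have "2 * ((v \<bullet> e - sqnorm v / 2) / \<sigma>\<^sup>2) = - 1 + ((2 / \<sigma>\<^sup>2) \<cdot>\<^sub>v v) \<bullet> e"
        using \<sigma> v that by (simp add: smult_scalar_prod_distrib[of _ n] field_simps)
      then show ?thesis unfolding L_def by (simp only: exp_double[symmetric] exp_add)
    qed
    then have "(\<integral>\<^sup>+ e. ennreal ((L e)\<^sup>2) \<partial>gauss_noise n \<sigma>) =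
      (\<integral>\<^sup>+ e. ennreal (exp (- 1)) * ennreal (exp (((2 / \<sigma>\<^sup>2) \<cdot>\<^sub>v v) \<bullet> e)) \<partial>gauss_noise n \<sigma>)"
      by (intro nn_integral_cong) (simp add: ennreal_mult)
    also have "\<dots> = ennreal (exp (- 1)) * (\<integral>\<^sup>+ e. ennreal (exp (((2 / \<sigma>\<^sup>2) \<cdot>\<^sub>v v) \<bullet> e)) \<partial>gauss_noise n \<sigma>)"
    proof (rule nn_integral_cmult)
      have "(\<lambda>e. ((2 / \<sigma>\<^sup>2) \<cdot>\<^sub>v v) \<bullet> e) \<in> borel_measurable (vec_borel n)"
        using v by (intro measurable_scalar_prod measurable_const measurable_ident) auto
      then show "(\<lambda>e. ennreal (exp (((2 / \<sigma>\<^sup>2) \<cdot>\<^sub>v v) \<bullet> e))) \<in> borel_measurable (gauss_noise n \<sigma>)"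
        by simp
    qed
    also have "\<dots> = ennreal (exp (- 1)) * ennreal (exp 2)"
    proof -
      have "\<sigma>\<^sup>2 / 2 * sqnorm ((2 / \<sigma>\<^sup>2) \<cdot>\<^sub>v v) = 2"
        using \<sigma> v(2) by (simp add: sqnorm_smult power_divide power2_eq_square)
      then show ?thesis using \<sigma> v(1) by (subst gauss_noise_mgf) auto
    qed
    also have "\<dots> = ennreal (exp 1)"
      by (simp add: ennreal_mult'[symmetric] mult_exp_exp)
    finally show ?thesis .
  qed
  have "L e \<le> min 1 (L e) + (L e)\<^sup>2 / 4" for e
  proof -
    have "0 \<le> (L e / 2 - 1)\<^sup>2" by simp
    then have "L e \<le> 1 + (L e)\<^sup>2 / 4" by (simp add: power2_eq_square field_simps)
    then show ?thesis by (simp add: min_def)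
  qed
  moreover have "ennreal (min 1 (L e) + (L e)\<^sup>2 / 4) = ennreal (min 1 (L e)) + ennreal (1 / 4) * ennreal ((L e)\<^sup>2)" for e
    by (subst ennreal_plus) (auto simp: L_def ennreal_mult[symmetric])
  ultimately have "ennreal (L e) \<le> ennreal (min 1 (L e)) + ennreal (1 / 4) * ennreal ((L e)\<^sup>2)" for e
    by (metis ennreal_leI)
  then have "(\<integral>\<^sup>+ e. ennreal (L e) \<partial>gauss_noise n \<sigma>) \<le>
    (\<integral>\<^sup>+ e. ennreal (min 1 (L e)) + ennreal (1 / 4) * ennreal ((L e)\<^sup>2) \<partial>gauss_noise n \<sigma>)"
    by (intro nn_integral_mono)
  also have "\<dots> = I + ennreal (1 / 4) * ennreal (exp 1)"
    unfolding I_def second_moment[symmetric]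
    by (subst nn_integral_add) (auto simp: nn_integral_cmult)
  also have "\<dots> \<le> I + ennreal (3 / 4)"
    using exp_le by (intro add_left_mono) (simp add: ennreal_mult[symmetric])
  finally have "1 \<le> I + ennreal (3 / 4)" by (simp add: mass)
  then have "ennreal (1 / 4) \<le> I"
  proof (cases I)
    case (real x)
    with \<open>1 \<le> I + ennreal (3 / 4)\<close> have "ennreal 1 \<le> ennreal (x + 3 / 4)"
      by (simp add: ennreal_plus[symmetric] del: ennreal_plus)
    then have "1 / 4 \<le> x" using real(1) by (subst (asm) ennreal_le_iff) auto
    then show ?thesis unfolding real(2) by (rule ennreal_leI)
  qed simp
  then show ?thesis by (simp add: I_def L_def)
qed

text \<open>Le Cam's two-point argument: no function of the data is close to \<open>- \<sigma> / 2\<close> under the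
  first mean and to \<open>\<sigma> / 2\<close> under the second one, because the two laws overlap.\<close>

lemma two_point_lower_bound:
  assumes \<sigma>: "\<sigma> > 0" and v: "v \<in> carrier_vec n" "sqnorm v = \<sigma>\<^sup>2" and \<mu>: "\<mu> \<in> carrier_vec n"
    and f: "f \<in> borel_measurable (vec_borel n)"
  shows "ennreal (\<sigma>\<^sup>2 / 8) \<le> (\<integral>\<^sup>+ e. ennreal ((f (\<mu> + e) + \<sigma> / 2)\<^sup>2) \<partial>gauss_noise n \<sigma>)
    + (\<integral>\<^sup>+ e. ennreal ((f (\<mu> + v + e) - \<sigma> / 2)\<^sup>2) \<partial>gauss_noise n \<sigma>)"
proof -
  define L where "L = (\<lambda>e. exp ((v \<bullet> e - sqnorm v / 2) / \<sigma>\<^sup>2))"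
  define g where "g = (\<lambda>e. f (\<mu> + e))"
  have "(\<lambda>e. \<mu> + e) \<in> measurable (vec_borel n) (vec_borel n)"
    using \<mu> by (intro measurable_vec_plus measurable_const measurable_ident) auto
  from measurable_compose[OF this f] have g [measurable]: "g \<in> borel_measurable (vec_borel n)"
    by (simp add: g_def)
  have vm [measurable]: "(\<lambda>e. v \<bullet> e) \<in> borel_measurable (vec_borel n)"
    using v by (intro measurable_scalar_prod measurable_const measurable_ident) auto
  have Lm [measurable]: "L \<in> borel_measurable (vec_borel n)" unfolding L_def by measurable
  have "(\<integral>\<^sup>+ e. ennreal ((f (\<mu> + v + e) - \<sigma> / 2)\<^sup>2) \<partial>gauss_noise n \<sigma>)
    = (\<integral>\<^sup>+ e. ennreal ((g (v + e) - \<sigma> / 2)\<^sup>2) \<partial>gauss_noise n \<sigma>)"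
    using v(1) \<mu> by (intro nn_integral_cong) (simp add: g_def assoc_add_vec[of _ n])
  also have "\<dots> = (\<integral>\<^sup>+ e. ennreal ((g e - \<sigma> / 2)\<^sup>2) * ennreal (L e) \<partial>gauss_noise n \<sigma>)"
    unfolding L_def by (rule gauss_noise_shift[OF \<sigma> v(1)]) measurable
  finally have shifted: "(\<integral>\<^sup>+ e. ennreal ((f (\<mu> + v + e) - \<sigma> / 2)\<^sup>2) \<partial>gauss_noise n \<sigma>)
    = (\<integral>\<^sup>+ e. ennreal ((g e - \<sigma> / 2)\<^sup>2) * ennreal (L e) \<partial>gauss_noise n \<sigma>)" .
  have pw: "ennreal (\<sigma>\<^sup>2 / 2) * ennreal (min 1 (L e)) \<le>
      ennreal ((g e + \<sigma> / 2)\<^sup>2) + ennreal ((g e - \<sigma> / 2)\<^sup>2) * ennreal (L e)" for e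
  proof -
    define m where "m = min 1 (L e)"
    have m: "0 \<le> m" "m \<le> 1" "m \<le> L e" by (auto simp: m_def L_def)
    have "\<sigma>\<^sup>2 / 2 \<le> (g e + \<sigma> / 2)\<^sup>2 + (g e - \<sigma> / 2)\<^sup>2"
      by (simp add: power2_eq_square algebra_simps)
    then have "\<sigma>\<^sup>2 / 2 * m \<le> ((g e + \<sigma> / 2)\<^sup>2 + (g e - \<sigma> / 2)\<^sup>2) * m"
      using m(1) by (rule mult_right_mono)
    also have "\<dots> = (g e + \<sigma> / 2)\<^sup>2 * m + (g e - \<sigma> / 2)\<^sup>2 * m" by (rule distrib_right)
    also have "\<dots> \<le> (g e + \<sigma> / 2)\<^sup>2 * 1 + (g e - \<sigma> / 2)\<^sup>2 * L e"
      using m by (intro add_mono mult_left_mono) auto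
    finally have "ennreal (\<sigma>\<^sup>2 / 2 * m) \<le> ennreal ((g e + \<sigma> / 2)\<^sup>2 + (g e - \<sigma> / 2)\<^sup>2 * L e)"
      by (intro ennreal_leI) simp
    moreover have "L e \<ge> 0" by (simp add: L_def)
    then have "ennreal ((g e + \<sigma> / 2)\<^sup>2 + (g e - \<sigma> / 2)\<^sup>2 * L e) =
        ennreal ((g e + \<sigma> / 2)\<^sup>2) + ennreal ((g e - \<sigma> / 2)\<^sup>2) * ennreal (L e)"
      by (simp add: ennreal_mult)
    moreover have "ennreal (\<sigma>\<^sup>2 / 2 * m) = ennreal (\<sigma>\<^sup>2 / 2) * ennreal m"
      using m(1) by (intro ennreal_mult) auto
    ultimately show ?thesis
      unfolding m_def[symmetric] by (simp only:)
  qed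
  have "ennreal (\<sigma>\<^sup>2 / 8) = ennreal (\<sigma>\<^sup>2 / 2) * ennreal (1 / 4)"
    by (simp add: ennreal_mult[symmetric])
  also have "\<dots> \<le> ennreal (\<sigma>\<^sup>2 / 2) * (\<integral>\<^sup>+ e. ennreal (min 1 (L e)) \<partial>gauss_noise n \<sigma>)"
    unfolding L_def by (intro mult_left_mono gauss_noise_overlap[OF \<sigma> v]) simp
  also have "\<dots> = (\<integral>\<^sup>+ e. ennreal (\<sigma>\<^sup>2 / 2) * ennreal (min 1 (L e)) \<partial>gauss_noise n \<sigma>)"
    by (rule nn_integral_cmult[symmetric]) simp
  also have "\<dots> \<le> (\<integral>\<^sup>+ e. ennreal ((g e + \<sigma> / 2)\<^sup>2) + ennreal ((g e - \<sigma> / 2)\<^sup>2) * ennreal (L e) \<partial>gauss_noise n \<sigma>)"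
    by (intro nn_integral_mono pw)
  also have "\<dots> = (\<integral>\<^sup>+ e. ennreal ((g e + \<sigma> / 2)\<^sup>2) \<partial>gauss_noise n \<sigma>)
      + (\<integral>\<^sup>+ e. ennreal ((g e - \<sigma> / 2)\<^sup>2) * ennreal (L e) \<partial>gauss_noise n \<sigma>)"
    by (rule nn_integral_add) simp_all
  finally show ?thesis unfolding shifted g_def .
qed

lemma sum_Pow_remove:
  fixes h :: "'a set \<Rightarrow> 'b :: comm_monoid_add"
  assumes "finite D" "i \<in> D"
  shows "(\<Sum>S\<in>Pow D. h S) = (\<Sum>S\<in>Pow (D - {i}). h S + h (insert i S))"
proof -
  have "Pow D = Pow (D - {i}) \<union> insert i ` Pow (D - {i})"
    using Pow_insert[of i "D - {i}"] assms(2) by (simp add: insert_absorb)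
  then have "(\<Sum>S\<in>Pow D. h S) = (\<Sum>S\<in>Pow (D - {i}). h S) + (\<Sum>S\<in>insert i ` Pow (D - {i}). h S)"
    using assms(1) by (simp only:) (intro sum.union_disjoint; auto)
  also have "(\<Sum>S\<in>insert i ` Pow (D - {i}). h S) = (\<Sum>S\<in>Pow (D - {i}). h (insert i S))"
    by (rule sum.reindex_cong[of "insert i"]) (auto simp: inj_on_def)
  finally show ?thesis by (simp add: sum.distrib)
qed

text \<open>Assouad's argument. In an orthonormal frame of the model space the means range over a cube
  with side \<open>\<sigma>\<close>; by Bessel's inequality the loss splits over the coordinates of the frame, and
  averaging over the vertices reduces each coordinate to the two-point bound. The coefficient
  vectors of the vertices must have support exactly \<open>M\<close>, so the cube is translated by
  the image of a large multiple \<open>T\<close> of the indicator of \<open>M\<close>.\<close>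

lemma (in sparse_design) max_risk_lower_bound:
  assumes \<sigma>: "\<sigma> > 0" and M: "M \<in> A" "M \<in> Ms" and t: "t \<in> estimators n"
  shows "ennreal (\<sigma>\<^sup>2 * real (card M) / 16) \<le> max_risk \<sigma> X Ms t"
proof -
  note M' = admissibleD[OF M(1)]
  define d where "d = card M"
  obtain U where U: "U \<in> carrier_mat n d" "transpose_mat U * U = 1\<^sub>m d"
    and span: "model_space X M = {U *\<^sub>v c |c. c \<in> carrier_vec d}"
    using orthonormal_frame_exists[OF X M'(3,1)] M'(4) unfolding d_def by blast
  have Ut: "transpose_mat U \<in> carrier_mat d n" using U(1) by simp
  define c where "c = (\<lambda>S. Matrix.vec d (\<lambda>i. if i \<in> S then 1 else - 1 :: real))"
  have c: "c S \<in> carrier_vec d" for S by (simp add: c_def)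
  have "\<forall>S. \<exists>b. b \<in> carrier_vec p \<and> supp b \<subseteq> M \<and> X *\<^sub>v b = U *\<^sub>v c S"
  proof
    fix S
    have "U *\<^sub>v c S \<in> model_space X M" unfolding span using c by blast
    then show "\<exists>b. b \<in> carrier_vec p \<and> supp b \<subseteq> M \<and> X *\<^sub>v b = U *\<^sub>v c S"
      using X by (elim model_spaceE) auto
  qed
  then obtain b where b: "\<And>S. b S \<in> carrier_vec p" "\<And>S. supp (b S) \<subseteq> M" "\<And>S. X *\<^sub>v b S = U *\<^sub>v c S"
    by metis
  define D where "D = {..<d}"
  define T where "T = 1 + (\<Sum>S\<in>Pow D. \<Sum>j\<in>M. \<bar>\<sigma> / 2 * b S $ j\<bar>)"
  have T: "\<bar>\<sigma> / 2 * b S $ j\<bar> < T" if "S \<in> Pow D" "j \<in> M" for S j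
  proof -
    have "\<bar>\<sigma> / 2 * b S $ j\<bar> \<le> (\<Sum>j\<in>M. \<bar>\<sigma> / 2 * b S $ j\<bar>)"
      using that(2) M'(3) by (intro member_le_sum[where f = "\<lambda>j. \<bar>\<sigma> / 2 * b S $ j\<bar>"]) auto
    also have "\<dots> \<le> (\<Sum>S\<in>Pow D. \<Sum>j\<in>M. \<bar>\<sigma> / 2 * b S $ j\<bar>)"
      using that(1) by (intro member_le_sum[where f = "\<lambda>S. \<Sum>j\<in>M. \<bar>\<sigma> / 2 * b S $ j\<bar>"]) (auto simp: D_def sum_nonneg)
    finally show ?thesis by (simp add: T_def)
  qed
  define a where "a = Matrix.vec p (\<lambda>j. if j \<in> M then T else 0)"
  define \<beta> where "\<beta> = (\<lambda>S. a + (\<sigma> / 2) \<cdot>\<^sub>v b S)"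
  define m where "m = X *\<^sub>v a"
  define \<mu> where "\<mu> = (\<lambda>S. m + (\<sigma> / 2) \<cdot>\<^sub>v (U *\<^sub>v c S))"
  have a: "a \<in> carrier_vec p" by (simp add: a_def)
  have m: "m \<in> carrier_vec n" by (simp add: m_def)
  have \<beta>: "\<beta> S \<in> coeffs p Ms" if "S \<in> Pow D" for S
  proof -
    have "supp (\<beta> S) = M"
    proof (intro Set.set_eqI iffI)
      fix j assume j: "j \<in> supp (\<beta> S)"
      show "j \<in> M"
      proof (rule ccontr)
        assume "j \<notin> M"
        then have "b S $ j = 0" "a $ j = 0" "j < p"
          using j b(1,2)[of S] a by (auto simp: supp_def a_def \<beta>_def)
        then show False using j b(1)[of S] a by (simp add: supp_def \<beta>_def)
      qed
    next
      fix j assume j: "j \<in> M"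
      then have "j < p" using M'(1) by auto
      moreover have "T + \<sigma> / 2 * b S $ j > 0" using T[OF that j] by linarith
      ultimately show "j \<in> supp (\<beta> S)"
        using j b(1)[of S] a by (auto simp: supp_def \<beta>_def a_def)
    qed
    then show ?thesis using M(2) a b(1) by (simp add: coeffs_def \<beta>_def)
  qed
  have X\<beta>: "X *\<^sub>v \<beta> S = \<mu> S" for S
    unfolding \<beta>_def \<mu>_def m_def using a b
    by (simp add: mult_add_distrib_mat_vec[OF X] mult_mat_vec[OF X])
  have \<mu>: "\<mu> S \<in> carrier_vec n" for S using m U(1) by (simp add: \<mu>_def)
  have tm: "t \<in> measurable (vec_borel n) (vec_borel n)" using t by (simp add: estimators_def)
  define f where "f = (\<lambda>i y. (transpose_mat U *\<^sub>v (t y - m)) $ i)"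
  have fm: "f i \<in> borel_measurable (vec_borel n)" if "i < d" for i
  proof -
    have "(\<lambda>y. t y - m) \<in> measurable (vec_borel n) (vec_borel n)"
      using tm m by (intro measurable_vec_minus measurable_const) auto
    from measurable_compose[OF measurable_mult_mat_vec[OF Ut this] measurable_vec_index[OF that]]
    show ?thesis by (simp add: f_def)
  qed
  define R where "R = (\<lambda>S i. \<integral>\<^sup>+ e. ennreal ((f i (\<mu> S + e) - \<sigma> / 2 * c S $ i)\<^sup>2) \<partial>gauss_noise n \<sigma>)"
  have shift_m: "(\<lambda>e. \<mu> S + e) \<in> measurable (vec_borel n) (vec_borel n)" for S
    using \<mu> by (intro measurable_vec_plus measurable_const measurable_ident) auto
  have risk_ge: "(\<Sum>i<d. R S i) \<le> max_risk \<sigma> X Ms t" if S: "S \<in> Pow D" for S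
  proof -
    have "(\<Sum>i<d. R S i) = (\<integral>\<^sup>+ e. (\<Sum>i<d. ennreal ((f i (\<mu> S + e) - \<sigma> / 2 * c S $ i)\<^sup>2)) \<partial>gauss_noise n \<sigma>)"
      unfolding R_def
    proof (rule nn_integral_sum[symmetric])
      fix i assume "i \<in> {..<d}"
      then have [measurable]: "(\<lambda>e. f i (\<mu> S + e)) \<in> borel_measurable (vec_borel n)"
        using measurable_compose[OF shift_m fm] by simp
      show "(\<lambda>e. ennreal ((f i (\<mu> S + e) - \<sigma> / 2 * c S $ i)\<^sup>2)) \<in> borel_measurable (gauss_noise n \<sigma>)"
        by simp
    qed
    also have "\<dots> \<le> (\<integral>\<^sup>+ e. ennreal (sqnorm (t (\<mu> S + e) - \<mu> S)) \<partial>gauss_noise n \<sigma>)"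
    proof (rule nn_integral_mono)
      fix e assume "e \<in> space (gauss_noise n \<sigma>)"
      then have e: "\<mu> S + e \<in> carrier_vec n" using \<mu> by simp
      define y where "y = t (\<mu> S + e)"
      have y: "y \<in> carrier_vec n" using measurable_space[OF tm] e by (simp add: y_def)
      define z where "z = transpose_mat U *\<^sub>v (y - \<mu> S)"
      have "transpose_mat U *\<^sub>v (U *\<^sub>v c S) = (transpose_mat U * U) *\<^sub>v c S"
        using U(1) c by (subst assoc_mult_mat_vec[of _ d n _ d]) auto
      then have Uc: "transpose_mat U *\<^sub>v (U *\<^sub>v c S) = c S"
        unfolding U(2) using c by simp
      have Ucn: "U *\<^sub>v c S \<in> carrier_vec n" using U(1) by simp
      have "y - \<mu> S = (y - m) - (\<sigma> / 2) \<cdot>\<^sub>v (U *\<^sub>v c S)"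
        using y m Ucn by (intro eq_vecI) (auto simp: \<mu>_def simp del: index_mult_mat_vec)
      then have "z = transpose_mat U *\<^sub>v (y - m) - transpose_mat U *\<^sub>v ((\<sigma> / 2) \<cdot>\<^sub>v (U *\<^sub>v c S))"
        unfolding z_def using y m Ucn
        by (simp only:) (intro mult_minus_distrib_mat_vec[OF Ut]; simp)
      also have "transpose_mat U *\<^sub>v ((\<sigma> / 2) \<cdot>\<^sub>v (U *\<^sub>v c S)) = (\<sigma> / 2) \<cdot>\<^sub>v c S"
        unfolding mult_mat_vec[OF Ut Ucn] Uc ..
      finally have z: "z = transpose_mat U *\<^sub>v (y - m) - (\<sigma> / 2) \<cdot>\<^sub>v c S" .
      have zi: "z $ i = f i (\<mu> S + e) - \<sigma> / 2 * c S $ i" if "i < d" for i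
        unfolding z f_def y_def using that c[of S] by (simp del: index_mult_mat_vec)
      have "z \<in> carrier_vec d" using U(1) by (simp add: z_def)
      then have "sqnorm z = (\<Sum>i<d. (z $ i)\<^sup>2)"
        by (simp add: sqnorm_def scalar_prod_lessThan power2_eq_square)
      also have "\<dots> = (\<Sum>i<d. (f i (\<mu> S + e) - \<sigma> / 2 * c S $ i)\<^sup>2)"
        by (intro sum.cong) (simp_all add: zi)
      finally have "(\<Sum>i<d. (f i (\<mu> S + e) - \<sigma> / 2 * c S $ i)\<^sup>2) \<le> sqnorm (y - \<mu> S)"
        unfolding z_def using bessel[OF U, of "y - \<mu> S"] y \<mu>[of S] by simp
      then show "(\<Sum>i<d. ennreal ((f i (\<mu> S + e) - \<sigma> / 2 * c S $ i)\<^sup>2)) \<le> ennreal (sqnorm (t (\<mu> S + e) - \<mu> S))"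
        unfolding y_def by (subst sum_ennreal) (auto intro: ennreal_leI)
    qed
    also have "\<dots> = risk \<sigma> X t (\<beta> S)"
      by (simp add: risk_def X\<beta>)
    also have "\<dots> \<le> max_risk \<sigma> X Ms t"
      unfolding max_risk_def using \<beta>[OF S] by (intro SUP_upper) simp
    finally show ?thesis .
  qed
  \<comment> \<open>Flipping one sign moves the mean by \<open>\<sigma>\<close> along one vector of the frame.\<close>
  have pair: "ennreal (\<sigma>\<^sup>2 / 8) \<le> R S i + R (insert i S) i" if i: "i < d" and S: "i \<notin> S" for S i
  proof -
    define v where "v = \<sigma> \<cdot>\<^sub>v (U *\<^sub>v unit_vec d i)"
    have v: "v \<in> carrier_vec n" using U(1) by (simp add: v_def)
    have "sqnorm (unit_vec d i :: real Matrix.vec) = 1"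
      unfolding sqnorm_def using i by simp
    then have nv: "sqnorm v = \<sigma>\<^sup>2"
      unfolding v_def sqnorm_smult by (simp add: sqnorm_orthonormal_frame[OF U])
    have "c (insert i S) = c S + 2 \<cdot>\<^sub>v unit_vec d i"
      using i S by (intro eq_vecI) (auto simp: c_def)
    then have "U *\<^sub>v c (insert i S) = U *\<^sub>v c S + 2 \<cdot>\<^sub>v (U *\<^sub>v unit_vec d i)"
      using c by (simp add: mult_add_distrib_mat_vec[OF U(1)] mult_mat_vec[OF U(1)])
    then have "\<mu> (insert i S) = \<mu> S + v"
      unfolding \<mu>_def v_def using m U(1)
      by (intro eq_vecI) (auto simp: algebra_simps simp del: index_mult_mat_vec)
    then show ?thesis
      using two_point_lower_bound[OF \<sigma> v nv \<mu> fm[OF i], of S] i S by (simp add: R_def c_def)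
  qed
  \<comment> \<open>Summing over the \<open>2 ^ d\<close> vertices, which each coordinate groups into \<open>2 ^ d / 2\<close> pairs.\<close>
  have "ennreal (2 ^ d) * ennreal (\<sigma>\<^sup>2 * real d / 16) = ennreal (2 ^ d * (\<sigma>\<^sup>2 * real d / 16))"
    by (rule ennreal_mult[symmetric]) simp_all
  also have "\<dots> = (\<Sum>i<d. \<Sum>S\<in>Pow (D - {i}). ennreal (\<sigma>\<^sup>2 / 8))"
  proof -
    have "(\<Sum>S\<in>Pow (D - {i}). ennreal (\<sigma>\<^sup>2 / 8)) = ennreal (2 ^ d / 2 * (\<sigma>\<^sup>2 / 8))" if "i < d" for i
    proof -
      have "card (Pow (D - {i})) = 2 ^ (d - 1)" using that by (simp add: card_Pow D_def)
      moreover have "(2::real) ^ (d - 1) = 2 ^ d / 2" using that by (cases d) auto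
      ultimately have "real (card (Pow (D - {i}))) = 2 ^ d / 2" by simp
      then show ?thesis
        by (subst sum_ennreal) simp_all
    qed
    then have "(\<Sum>i<d. \<Sum>S\<in>Pow (D - {i}). ennreal (\<sigma>\<^sup>2 / 8)) = (\<Sum>i<d. ennreal (2 ^ d / 2 * (\<sigma>\<^sup>2 / 8)))"
      by (intro sum.cong) auto
    also have "\<dots> = ennreal (2 ^ d * (\<sigma>\<^sup>2 * real d / 16))"
      by (subst sum_ennreal) (simp_all add: algebra_simps)
    finally show ?thesis ..
  qed
  also have "\<dots> \<le> (\<Sum>i<d. \<Sum>S\<in>Pow (D - {i}). R S i + R (insert i S) i)"
    using pair by (intro sum_mono) auto
  also have "\<dots> = (\<Sum>i<d. \<Sum>S\<in>Pow D. R S i)"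
    by (intro sum.cong refl sum_Pow_remove[symmetric]) (auto simp: D_def)
  also have "\<dots> = (\<Sum>S\<in>Pow D. \<Sum>i<d. R S i)" by (rule sum.swap)
  also have "\<dots> \<le> (\<Sum>S\<in>Pow D. max_risk \<sigma> X Ms t)"
    by (intro sum_mono risk_ge)
  also have "\<dots> = ennreal (2 ^ d) * max_risk \<sigma> X Ms t"
    by (simp add: D_def card_Pow ennreal_of_nat_eq_real_of_nat)
  finally have "ennreal (2 ^ d) * ennreal (\<sigma>\<^sup>2 * real d / 16) \<le> ennreal (2 ^ d) * max_risk \<sigma> X Ms t" .
  then show ?thesis
    unfolding d_def[symmetric] by (subst (asm) ennreal_mult_le_mult_iff) auto
qed


section \<open>Rates\<close>

lemma sum_half_powers_le: "(\<Sum>k\<le>r. (1 / 2) ^ k) \<le> (2 :: real)"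
proof -
  have "(\<Sum>k\<le>r. (1 / 2) ^ k) = 2 - (1 / 2 :: real) ^ r"
    by (induction r) (simp_all add: field_simps)
  then show ?thesis by simp
qed

lemma (in sparse_design) measurable_map_est:
  assumes "Mhat \<in> measurable (vec_borel n) (count_space A)"
  shows "map_est X Mhat \<in> estimators n"
proof -
  have "(\<lambda>y. (\<lambda>M y. X *\<^sub>v ls_est X M y) (Mhat y) y) \<in> measurable (vec_borel n) (vec_borel n)"
  proof (rule measurable_compose_countable'[OF _ assms])
    fix M assume "M \<in> A"
    then have "indep_on X M" by (rule admissibleD)
    from measurable_ls_est[OF X this]
    show "(\<lambda>y. X *\<^sub>v ls_est X M y) \<in> measurable (vec_borel n) (vec_borel n)"
      by (rule measurable_mult_mat_vec[OF X])
  qed (simp add: finite_admissible countable_finite)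
  then show ?thesis by (simp add: estimators_def map_est_def[abs_def])
qed

text \<open>The oracle inequality for \<open>t = \<theta> = 1 / 2\<close> and a penalty linear in the model size. Its
  slope, \<open>K + 2\<close> in units of \<open>8 * \<sigma>\<^sup>2\<close>, outweighs the number \<open>exp (K * k)\<close> of models of size \<open>k\<close> and the
  chi-square factor, which is at most \<open>exp k\<close>, and leaves a summable \<open>exp (- k)\<close>.\<close>

lemma (in sparse_design) minimax_risk_upper_bound:
  assumes \<sigma>: "\<sigma> > 0" and K: "K \<ge> 0"
    and count: "\<And>k. k \<le> r \<Longrightarrow> real (num_models A k) \<le> exp (K * real k)"
    and p0: "1 \<le> p0"
  shows "minimax_risk \<sigma> X (models_upto A p0) \<le> ennreal (16 * (K + 5) * (\<sigma>\<^sup>2 * real p0))"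
proof -
  define pen where "pen = (\<lambda>M :: nat set. 8 * \<sigma>\<^sup>2 * (K + 2) * real (card M))"
  define f where "f = (\<lambda>y M. sqnorm (y - X *\<^sub>v ls_est X M y) + pen M)"
  have "(\<lambda>y. f y M) \<in> borel_measurable (vec_borel n)" if "M \<in> A" for M
  proof -
    have "(\<lambda>y. X *\<^sub>v ls_est X M y) \<in> measurable (vec_borel n) (vec_borel n)"
      by (rule measurable_mult_mat_vec[OF X measurable_ls_est[OF X admissibleD(4)[OF that]]])
    from measurable_vec_minus[OF measurable_ident[unfolded id_def] this]
    have [measurable]: "(\<lambda>y. sqnorm (y - X *\<^sub>v ls_est X M y)) \<in> borel_measurable (vec_borel n)"
      by (rule measurable_sqnorm)
    show ?thesis unfolding f_def by measurable
  qed
  then obtain Mhat where meas: "Mhat \<in> measurable (vec_borel n) (count_space A)"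
    and MA: "\<And>y. Mhat y \<in> A" and opt: "\<And>y M. M \<in> A \<Longrightarrow> f y (Mhat y) \<le> f y M"
    using measurable_arg_min_selection[OF finite_admissible, of f "vec_borel n"] null_admissible by blast
  have ln2: "ln 2 \<le> (1 :: real)" using ln_le_minus_one[of "2::real"] by simp
  have S: "(\<Sum>M\<in>A. exp (- (1 / 2 * (1 / 2) / (2 * \<sigma>\<^sup>2)) * pen M) * (1 - 1 / 2) powr (- real (card M) / 2)) \<le> 2"
  proof -
    have "(\<Sum>M\<in>A. exp (- (1 / 2 * (1 / 2) / (2 * \<sigma>\<^sup>2)) * pen M) * (1 - 1 / 2) powr (- real (card M) / 2))
       = (\<Sum>k\<le>r. real (num_models A k) * exp (- (K + 2) * real k + real k / 2 * ln 2))"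
      unfolding sum_over_sizes[symmetric]
    proof (intro sum.cong refl)
      fix M :: "nat set"
      have "- (1 / 2 * (1 / 2) / (2 * \<sigma>\<^sup>2)) * pen M = - (K + 2) * real (card M)"
        using \<sigma> by (simp add: pen_def algebra_simps)
      moreover have "(1 - 1 / 2 :: real) powr (- real (card M) / 2) = exp (real (card M) / 2 * ln 2)"
        by (simp add: powr_def ln_div)
      ultimately show "exp (- (1 / 2 * (1 / 2) / (2 * \<sigma>\<^sup>2)) * pen M) * (1 - 1 / 2) powr (- real (card M) / 2) =
          exp (- (K + 2) * real (card M) + real (card M) / 2 * ln 2)"
        by (simp only: exp_add)
    qed
    also have "\<dots> \<le> (\<Sum>k\<le>r. (1 / 2) ^ k)"
    proof (intro sum_mono)
      fix k assume "k \<in> {..r}"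
      then have "real (num_models A k) * exp (- (K + 2) * real k + real k / 2 * ln 2) \<le>
          exp (K * real k) * exp (- (K + 2) * real k + real k / 2 * ln 2)"
        using count by (intro mult_right_mono) auto
      also have "\<dots> = exp (- 2 * real k + real k / 2 * ln 2)"
        by (simp add: mult_exp_exp algebra_simps)
      also have "\<dots> \<le> exp (- real k)"
      proof -
        have "real k / 2 * ln 2 \<le> real k / 2 * 1" using ln2 by (intro mult_left_mono) auto
        then show ?thesis by simp
      qed
      also have "\<dots> = exp (- 1) ^ k" using exp_of_nat_mult[of k "- 1 :: real"] by simp
      also have "\<dots> \<le> (1 / 2) ^ k"
      proof (rule power_mono)
        have "2 \<le> exp (1 :: real)" using exp_ge_add_one_self[of "1::real"] by simp
        then show "exp (- 1 :: real) \<le> 1 / 2" by (simp add: exp_minus field_simps)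
      qed simp
      finally show "real (num_models A k) * exp (- (K + 2) * real k + real k / 2 * ln 2) \<le> (1 / 2) ^ k" .
    qed
    also have "\<dots> \<le> 2" by (rule sum_half_powers_le)
    finally show ?thesis .
  qed
  have "max_risk \<sigma> X (models_upto A p0) (map_est X Mhat) \<le> ennreal (16 * (K + 5) * (\<sigma>\<^sup>2 * real p0))"
    unfolding max_risk_def dim_X
  proof (rule SUP_least)
    fix b assume "b \<in> coeffs p (models_upto A p0)"
    then have b: "b \<in> carrier_vec p" "supp b \<in> A" "card (supp b) \<le> p0"
      by (auto simp: coeffs_def models_upto_def models_of_size_def)
    have "risk \<sigma> X (map_est X Mhat) b \<le> ennreal (1 / (1 - 1 / 2) * (pen (supp b) +
        2 * \<sigma>\<^sup>2 / (1 / 2 * (1 / 2)) * (real (card (supp b)) / 2 * ln (1 / (1 - 1 / 2)) + 2)))"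
      by (rule map_est_risk_le[OF \<sigma> _ _ _ _ MA _ S b(2) _ b(1)])
        (use opt K in \<open>auto simp: f_def pen_def\<close>)
    also have "\<dots> \<le> ennreal (16 * (K + 5) * (\<sigma>\<^sup>2 * real p0))"
    proof (rule ennreal_leI)
      define q where "q = real (card (supp b))"
      have q: "0 \<le> q" "q \<le> real p0" using b(3) by (auto simp: q_def)
      have "q / 2 * ln 2 + 2 \<le> 3 * real p0"
      proof -
        have "q / 2 * ln 2 \<le> real p0 * 1" using q ln2 by (intro mult_mono) auto
        then show ?thesis using p0 by linarith
      qed
      then have "8 * \<sigma>\<^sup>2 * (K + 2) * q + 8 * \<sigma>\<^sup>2 * (q / 2 * ln 2 + 2) \<le>
          8 * \<sigma>\<^sup>2 * (K + 2) * real p0 + 8 * \<sigma>\<^sup>2 * (3 * real p0)"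
        using q K by (intro add_mono mult_left_mono) auto
      then show "1 / (1 - 1 / 2) * (pen (supp b) +
        2 * \<sigma>\<^sup>2 / (1 / 2 * (1 / 2)) * (real (card (supp b)) / 2 * ln (1 / (1 - 1 / 2)) + 2))
        \<le> 16 * (K + 5) * (\<sigma>\<^sup>2 * real p0)"
        by (simp add: pen_def q_def algebra_simps)
    qed
    finally show "risk \<sigma> X (map_est X Mhat) b \<le> ennreal (16 * (K + 5) * (\<sigma>\<^sup>2 * real p0))" .
  qed
  moreover have "minimax_risk \<sigma> X (models_upto A p0) \<le> max_risk \<sigma> X (models_upto A p0) (map_est X Mhat)"
    unfolding minimax_risk_def dim_X using measurable_map_est[OF meas] by (rule INF_lower)
  ultimately show ?thesis by (rule order_trans[rotated])
qed

text \<open>The factor that the oracle inequality delivers for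
  \<open>t = (\<gamma> + 1 / 2) / (\<gamma> + 1)\<close> and \<open>\<theta> = (4 * \<gamma> + 1) / (4 * \<gamma> + 2)\<close>, the
  values for which the penalty of the MAP criterion is large enough.\<close>

definition map_risk_factor :: "real \<Rightarrow> real \<Rightarrow> real \<Rightarrow> real" where
  "map_risk_factor \<gamma> c K = (4 * \<gamma> + 2) * (2 * (1 + 1 / \<gamma>) * (K + c + ln (1 + \<gamma>) / 2) +
     8 * (\<gamma> + 1) / (4 * \<gamma> + 1) * (ln (2 * (\<gamma> + 1)) / 2 + 1))"

lemma map_risk_factor_pos:
  assumes "\<gamma> > 0" "c > 0" "K \<ge> 0"
  shows "map_risk_factor \<gamma> c K > 0"
  unfolding map_risk_factor_def using assms
  by (intro mult_pos_pos add_pos_pos divide_pos_pos add_nonneg_pos) auto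

text \<open>With \<open>lw k = ln (num_models A k / pmf \<pi> k)\<close> the weights \<open>exp (- lw (card M))\<close>
  sum to at most 1 over all models, being the prior probabilities of the models. For
  \<open>\<theta> = 1\<close> and \<open>1 - t = 1 / (1 + \<gamma>)\<close> the summability condition of the oracle
  inequality would hold with exactly these weights. The oracle inequality needs \<open>\<theta> < 1\<close>,
  so \<open>t\<close> is moved up to \<open>1 - t = 1 / (2 * (\<gamma> + 1))\<close>, which costs a factor
  \<open>2 powr (k / 2)\<close>. The surplus \<open>lw k / (4 * \<gamma>)\<close> then created by the exponent pays for it,
  because the upper bound on the prior makes \<open>lw k\<close> at least
  \<open>8 * (\<gamma> + 3 / 4)\<^sup>2 * k\<close>. The lower bound on the prior controls the penalty of
  the comparison model \<open>M0\<close>.\<close>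

lemma (in sparse_design) map_risk_upper_bound:
  assumes \<sigma>: "\<sigma> > 0" and \<gamma>: "\<gamma> > 0" and c: "c > 0" and K: "K \<ge> 0"
    and count: "\<And>k. k \<le> r \<Longrightarrow> real (num_models A k) \<le> exp (K * real k)"
    and prior: "size_prior r A \<pi>"
    and prior_bounds: "\<And>k. k \<in> {1..r} \<Longrightarrow> num_models A k > 0 \<Longrightarrow> exp (- c * real k) \<le> pmf \<pi> k \<and>
      pmf \<pi> k \<le> real (num_models A k) * exp (- (8 * (\<gamma> + 3 / 4)\<^sup>2) * real k)"
    and map: "is_map_model \<sigma> \<gamma> X A \<pi> Mhat"
    and M0: "M0 \<in> A" "M0 \<noteq> {}" and b: "b \<in> carrier_vec p" "supp b \<subseteq> M0"
  shows "risk \<sigma> X (map_est X Mhat) b \<le> ennreal (map_risk_factor \<gamma> c K * (\<sigma>\<^sup>2 * real (card M0)))"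
proof -
  define lw where "lw = (\<lambda>k. ln (real (num_models A k) / pmf \<pi> k))"
  define pen where "pen = (\<lambda>M :: nat set. 2 * \<sigma>\<^sup>2 * (1 + 1 / \<gamma>) *
    ln (real (num_models A (card M)) * inverse (pmf \<pi> (card M)) * (1 + \<gamma>) powr (real (card M) / 2)))"
  define t where "t = (\<gamma> + 1 / 2) / (\<gamma> + 1)"
  define \<theta> where "\<theta> = (4 * \<gamma> + 1) / (4 * \<gamma> + 2)"
  have t: "0 < t" "t < 1" "1 - t = 1 / (2 * (\<gamma> + 1))" using \<gamma> by (auto simp: t_def field_simps)
  have \<theta>: "0 < \<theta>" "\<theta> < 1" "1 - \<theta> = 1 / (4 * \<gamma> + 2)" using \<gamma> by (auto simp: \<theta>_def field_simps)
  have t\<theta>: "t * \<theta> = (4 * \<gamma> + 1) / (4 * (\<gamma> + 1))"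
  proof -
    have "t = (4 * \<gamma> + 2) / (4 * (\<gamma> + 1))" using \<gamma> by (simp add: t_def field_simps)
    then show ?thesis using \<gamma> by (simp add: \<theta>_def)
  qed
  have pos: "real (num_models A (card M)) > 0" "pmf \<pi> (card M) > 0" if "M \<in> A" for M
  proof -
    show 1: "real (num_models A (card M)) > 0" using num_models_pos[OF that] by simp
    then have "pmf \<pi> (card M) \<noteq> 0"
      using prior admissibleD(2)[OF that] by (auto simp: size_prior_def)
    then show "pmf \<pi> (card M) > 0" using pmf_nonneg[of \<pi> "card M"] by linarith
  qed
  have pen_eq: "pen M = 2 * \<sigma>\<^sup>2 * (1 + 1 / \<gamma>) * (lw (card M) + real (card M) / 2 * ln (1 + \<gamma>))" if "M \<in> A" for M
    using pos[OF that] \<gamma> unfolding pen_def lw_def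
    by (simp add: ln_mult ln_div ln_powr ln_inverse)
  have lw_ge: "lw (card M) \<ge> 8 * (\<gamma> + 3 / 4)\<^sup>2 * real (card M)" if "M \<in> A" for M
  proof (cases "card M = 0")
    case True
    have "pmf \<pi> 0 \<le> 1" by (rule pmf_le_1)
    then show ?thesis
      using pos[OF that] num_models_0 unfolding lw_def True by (simp add: ln_div)
  next
    case False
    then have "card M \<in> {1..r}" using admissibleD(2)[OF that] by auto
    then have "pmf \<pi> (card M) \<le> real (num_models A (card M)) * exp (- (8 * (\<gamma> + 3 / 4)\<^sup>2) * real (card M))"
      using prior_bounds num_models_pos[OF that] by blast
    then have "exp (8 * (\<gamma> + 3 / 4)\<^sup>2 * real (card M)) \<le> real (num_models A (card M)) / pmf \<pi> (card M)"
      using pos[OF that] by (simp add: exp_minus field_simps)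
    then show ?thesis
      unfolding lw_def using pos[OF that] by (subst ln_ge_iff) auto
  qed
  have pen_nonneg: "pen M \<ge> 0" if "M \<in> A" for M
  proof -
    have "0 \<le> 8 * (\<gamma> + 3 / 4)\<^sup>2 * real (card M)" by simp
    with lw_ge[OF that] have "lw (card M) \<ge> 0" by linarith
    then show ?thesis unfolding pen_eq[OF that] using \<gamma> by simp
  qed
  have S: "(\<Sum>M\<in>A. exp (- (t * \<theta> / (2 * \<sigma>\<^sup>2)) * pen M) * (1 - t) powr (- real (card M) / 2)) \<le> 1"
  proof -
    have "(\<Sum>M\<in>A. exp (- (t * \<theta> / (2 * \<sigma>\<^sup>2)) * pen M) * (1 - t) powr (- real (card M) / 2)) \<le>
      (\<Sum>M\<in>A. pmf \<pi> (card M) / real (num_models A (card M)))"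
    proof (rule sum_mono)
      fix M assume M: "M \<in> A"
      define k where "k = real (card M)"
      define u where "u = lw (card M)"
      define g where "g = ln (1 + \<gamma>)"
      define l2 :: real where "l2 = ln 2"
      have g: "g \<ge> 0" using \<gamma> by (simp add: g_def)
      have k: "k \<ge> 0" by (simp add: k_def)
      have "t * \<theta> / (2 * \<sigma>\<^sup>2) * pen M = (t * \<theta> * (1 + 1 / \<gamma>)) * (u + k / 2 * g)"
        unfolding pen_eq[OF M] u_def k_def g_def using \<sigma> by simp
      also have "t * \<theta> * (1 + 1 / \<gamma>) = 1 + 1 / (4 * \<gamma>)"
        unfolding t\<theta> using \<gamma> by (simp add: divide_simps)
      finally have e1: "t * \<theta> / (2 * \<sigma>\<^sup>2) * pen M = (1 + 1 / (4 * \<gamma>)) * (u + k / 2 * g)" .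
      have e2: "(1 - t) powr (- k / 2) = exp (k / 2 * (l2 + g))"
      proof -
        have "ln (1 - t) = - ln (2 * (\<gamma> + 1))"
          unfolding t(3) using \<gamma> by (simp add: ln_div)
        also have "ln (2 * (\<gamma> + 1)) = l2 + g"
          unfolding l2_def g_def using \<gamma> by (subst ln_mult) (auto simp: add.commute)
        finally have l: "ln (1 - t) = - (l2 + g)" .
        have "- k / 2 * ln (1 - t) = k / 2 * (l2 + g)"
          unfolding l by (simp only: minus_divide_left[symmetric] mult_minus_left mult_minus_right minus_minus)
        then show ?thesis using t(2) by (simp add: powr_def del: ring_distribs)
      qed
      \<comment> \<open>This is where the constant \<open>8 * (\<gamma> + 3 / 4)\<^sup>2\<close> enters.\<close>
      have slack: "k / 2 * l2 \<le> 1 / (4 * \<gamma>) * (u + k / 2 * g)"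
      proof -
        have "l2 \<le> 1" unfolding l2_def using ln_le_minus_one[of "2::real"] by simp
        then have "k / 2 * l2 \<le> k / 2 * 1" using k by (intro mult_left_mono) auto
        also have "\<dots> \<le> 3 * k" using k by simp
        also have "\<dots> = 1 / (4 * \<gamma>) * (8 * (3 / 2 * \<gamma>) * k)" using \<gamma> by simp
        also have "\<dots> \<le> 1 / (4 * \<gamma>) * (8 * (\<gamma> + 3 / 4)\<^sup>2 * k)"
        proof -
          have "3 / 2 * \<gamma> \<le> (\<gamma> + 3 / 4)\<^sup>2" by (simp add: power2_eq_square algebra_simps)
          then show ?thesis using \<gamma> k by (intro mult_left_mono mult_right_mono) auto
        qed
        also have "\<dots> \<le> 1 / (4 * \<gamma>) * (u + k / 2 * g)"
          using lw_ge[OF M] \<gamma> k g unfolding u_def k_def by (intro mult_left_mono) (auto intro: add_increasing2)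
        finally show ?thesis .
      qed
      have "- ((1 + 1 / (4 * \<gamma>)) * (u + k / 2 * g)) + k / 2 * (l2 + g) \<le> - u"
      proof -
        define w where "w = 1 / (4 * \<gamma>) * (u + k / 2 * g)"
        have 1: "(1 + 1 / (4 * \<gamma>)) * (u + k / 2 * g) = u + k / 2 * g + w"
          unfolding w_def by (simp only: distrib_right mult_1_left)
        have 2: "k / 2 * (l2 + g) = k / 2 * l2 + k / 2 * g" by (rule distrib_left)
        show ?thesis using slack unfolding 1 2 w_def[symmetric] by simp
      qed
      then have "exp (- ((1 + 1 / (4 * \<gamma>)) * (u + k / 2 * g))) * exp (k / 2 * (l2 + g)) \<le> exp (- u)"
        by (simp only: mult_exp_exp exp_le_cancel_iff)
      also have "exp (- u) = pmf \<pi> (card M) / real (num_models A (card M))"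
        using pos[OF M] by (simp add: u_def lw_def exp_minus)
      finally show "exp (- (t * \<theta> / (2 * \<sigma>\<^sup>2)) * pen M) * (1 - t) powr (- real (card M) / 2)
          \<le> pmf \<pi> (card M) / real (num_models A (card M))"
        unfolding mult_minus_left e1 k_def[symmetric] e2 .
    qed
    also have "\<dots> = (\<Sum>k\<le>r. real (num_models A k) * (pmf \<pi> k / real (num_models A k)))"
      by (rule sum_over_sizes)
    also have "\<dots> \<le> (\<Sum>k\<le>r. pmf \<pi> k)" by (intro sum_mono) simp
    also have "\<dots> = measure (measure_pmf \<pi>) {..r}"
      by (rule measure_measure_pmf_finite[symmetric]) simp
    also have "\<dots> \<le> 1" by (rule measure_pmf.prob_le_1)
    finally show ?thesis .
  qed
  have MA: "Mhat y \<in> A" and opt: "map_crit \<sigma> \<gamma> X A \<pi> y (Mhat y) \<le> map_crit \<sigma> \<gamma> X A \<pi> y M"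
    if "y \<in> carrier_vec n" "M \<in> A" for y M
    using map that by (auto simp: is_map_model_def is_arg_min_linorder)
  have MA': "Mhat y \<in> A" if "y \<in> carrier_vec n" for y using MA[OF that M0(1)] .
  have opt': "sqnorm (y - X *\<^sub>v ls_est X (Mhat y) y) + pen (Mhat y) \<le> sqnorm (y - X *\<^sub>v ls_est X M y) + pen M"
    if "y \<in> carrier_vec n" "M \<in> A" for y M
    using opt[OF that] by (simp only: map_crit_def pen_def)
  have "risk \<sigma> X (map_est X Mhat) b \<le> ennreal (1 / (1 - \<theta>) *
    (pen M0 + 2 * \<sigma>\<^sup>2 / (t * \<theta>) * (real (card M0) / 2 * ln (1 / (1 - t)) + 1)))"
    by (rule map_est_risk_le[OF \<sigma> t(1,2) \<theta>(1,2) MA' opt' S M0(1) pen_nonneg[OF M0(1)] b])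
  also have "\<dots> \<le> ennreal (map_risk_factor \<gamma> c K * (\<sigma>\<^sup>2 * real (card M0)))"
  proof (rule ennreal_leI)
    define k where "k = real (card M0)"
    have "card M0 > 0" using M0 admissibleD(3) by (simp add: card_gt_0_iff)
    then have k: "k \<ge> 1" and range: "card M0 \<in> {1..r}"
      using admissibleD(2)[OF M0(1)] by (auto simp: k_def)
    have "lw (card M0) = ln (real (num_models A (card M0))) - ln (pmf \<pi> (card M0))"
      unfolding lw_def using pos[OF M0(1)] by (simp add: ln_div)
    moreover have "ln (real (num_models A (card M0))) \<le> K * k"
      unfolding k_def using count[of "card M0"] range pos(1)[OF M0(1)]
      by (metis atLeastAtMost_iff exp_le_cancel_iff exp_ln)
    moreover have "- (c * k) \<le> ln (pmf \<pi> (card M0))"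
      using prior_bounds[OF range num_models_pos[OF M0(1)]] pos(2)[OF M0(1)]
      unfolding k_def by (subst ln_ge_iff) auto
    ultimately have "lw (card M0) + k / 2 * ln (1 + \<gamma>) \<le> (K + c + ln (1 + \<gamma>) / 2) * k"
      by (simp add: algebra_simps)
    then have 1: "pen M0 \<le> 2 * \<sigma>\<^sup>2 * (1 + 1 / \<gamma>) * ((K + c + ln (1 + \<gamma>) / 2) * k)"
      unfolding pen_eq[OF M0(1)] k_def using \<gamma> by (intro mult_left_mono) auto
    have "k / 2 * ln (2 * (\<gamma> + 1)) + 1 \<le> (ln (2 * (\<gamma> + 1)) / 2 + 1) * k"
      using k by (simp add: algebra_simps)
    then have 2: "2 * \<sigma>\<^sup>2 / (t * \<theta>) * (k / 2 * ln (2 * (\<gamma> + 1)) + 1) \<le>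
        2 * \<sigma>\<^sup>2 / (t * \<theta>) * ((ln (2 * (\<gamma> + 1)) / 2 + 1) * k)"
      using t \<theta> by (intro mult_left_mono) auto
    have "1 / (1 - \<theta>) * (pen M0 + 2 * \<sigma>\<^sup>2 / (t * \<theta>) * (k / 2 * ln (1 / (1 - t)) + 1)) =
        (4 * \<gamma> + 2) * (pen M0 + 2 * \<sigma>\<^sup>2 / (t * \<theta>) * (k / 2 * ln (2 * (\<gamma> + 1)) + 1))"
      unfolding t(3) \<theta>(3) by simp
    also have "\<dots> \<le> (4 * \<gamma> + 2) * (2 * \<sigma>\<^sup>2 * (1 + 1 / \<gamma>) * ((K + c + ln (1 + \<gamma>) / 2) * k) +
        2 * \<sigma>\<^sup>2 / (t * \<theta>) * ((ln (2 * (\<gamma> + 1)) / 2 + 1) * k))"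
      by (rule mult_left_mono[OF add_mono[OF 1 2]]) (use \<gamma> in simp)
    also have "\<dots> = map_risk_factor \<gamma> c K * (\<sigma>\<^sup>2 * k)"
    proof -
      have t\<theta>': "2 * \<sigma>\<^sup>2 / (t * \<theta>) = \<sigma>\<^sup>2 * (8 * (\<gamma> + 1) / (4 * \<gamma> + 1))"
        unfolding t\<theta> by simp
      have alg: "a * (2 * s * x * (y * k) + s * z * (w * k)) = a * (2 * x * y + z * w) * (s * k)" for a s x y z w :: real
        by (simp add: algebra_simps)
      show ?thesis unfolding t\<theta>' map_risk_factor_def by (rule alg)
    qed
    finally show "1 / (1 - \<theta>) * (pen M0 + 2 * \<sigma>\<^sup>2 / (t * \<theta>) * (real (card M0) / 2 * ln (1 / (1 - t)) + 1))
      \<le> map_risk_factor \<gamma> c K * (\<sigma>\<^sup>2 * real (card M0))"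
      unfolding k_def .
  qed
  finally show ?thesis .
qed

lemma (in sparse_design) minimax_risk_lower_bound:
  assumes \<sigma>: "\<sigma> > 0" and M: "M \<in> A" "M \<in> Ms"
  shows "ennreal (\<sigma>\<^sup>2 * real (card M) / 16) \<le> minimax_risk \<sigma> X Ms"
  unfolding minimax_risk_def dim_X
  by (intro INF_greatest max_risk_lower_bound[OF \<sigma> M])

text \<open>Both risks are compared with \<open>\<sigma>\<^sup>2 * ks\<close>, where \<open>ks\<close> is the largest admissible
  size up to \<open>p0\<close>.\<close>

lemma (in sparse_design) map_estimator_rate_optimal:
  assumes \<sigma>: "\<sigma> > 0" and \<gamma>: "\<gamma> > 0" and c: "c > 0" and K: "K \<ge> 0"
    and count: "\<And>k. k \<le> r \<Longrightarrow> real (num_models A k) \<le> exp (K * real k)"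
    and prior: "size_prior r A \<pi>"
    and prior_bounds: "\<And>k. k \<in> {1..r} \<Longrightarrow> num_models A k > 0 \<Longrightarrow> exp (- c * real k) \<le> pmf \<pi> k \<and>
      pmf \<pi> k \<le> real (num_models A k) * exp (- (8 * (\<gamma> + 3 / 4)\<^sup>2) * real k)"
    and map: "is_map_model \<sigma> \<gamma> X A \<pi> Mhat"
    and nontrivial: "\<exists>k\<in>{1..p0}. num_models A k > 0"
  shows "max_risk \<sigma> X (models_upto A p0) (map_est X Mhat) \<le>
    ennreal (16 * map_risk_factor \<gamma> c K) * minimax_risk \<sigma> X (models_upto A p0)"
proof -
  define Q where "Q = {k \<in> {1..p0}. num_models A k > 0}"
  define ks where "ks = Max Q"
  define C where "C = map_risk_factor \<gamma> c K"
  have C: "C > 0" unfolding C_def using \<gamma> c K by (rule map_risk_factor_pos)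
  have Q: "finite Q" "Q \<noteq> {}" using nontrivial by (auto simp: Q_def)
  have "ks \<in> Q" unfolding ks_def using Q by (rule Max_in)
  then have ks: "1 \<le> ks" "ks \<le> p0" "num_models A ks > 0" by (auto simp: Q_def)
  then have "models_of_size A ks \<noteq> {}" by (auto simp: num_models_def)
  then obtain Ms where Ms: "Ms \<in> A" "card Ms = ks" by (auto simp: models_of_size_def)
  then have Ms_ne: "Ms \<noteq> {}" using ks by auto
  have "risk \<sigma> X (map_est X Mhat) b \<le> ennreal (C * (\<sigma>\<^sup>2 * real ks))"
    if "b \<in> coeffs p (models_upto A p0)" for b
  proof -
    have b: "b \<in> carrier_vec p" "supp b \<in> A" "card (supp b) \<le> p0"
      using that by (auto simp: coeffs_def models_upto_def models_of_size_def)
    \<comment> \<open>The prior of the null model has no lower bound, so its penalty can be arbitrarily large. The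
      zero mean vector also belongs to every other model space, and \<open>Ms\<close> serves for comparison.\<close>
    obtain M0 where M0: "M0 \<in> A" "M0 \<noteq> {}" "supp b \<subseteq> M0" "card M0 \<le> ks"
    proof (cases "supp b = {}")
      case True
      then show thesis using that[of Ms] Ms Ms_ne by simp
    next
      case False
      then have "card (supp b) \<in> Q"
        using b num_models_pos[OF b(2)] by (auto simp: Q_def Suc_le_eq card_gt_0_iff)
      then have "card (supp b) \<le> ks" unfolding ks_def using Q by simp
      then show thesis using that[of "supp b"] b False by simp
    qed
    have "risk \<sigma> X (map_est X Mhat) b \<le> ennreal (C * (\<sigma>\<^sup>2 * real (card M0)))"
      unfolding C_def
      by (rule map_risk_upper_bound[OF \<sigma> \<gamma> c K count prior prior_bounds map M0(1,2) b(1) M0(3)])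
    also have "\<dots> \<le> ennreal (C * (\<sigma>\<^sup>2 * real ks))"
      using C M0(4) by (intro ennreal_leI mult_left_mono) auto
    finally show ?thesis .
  qed
  then have "max_risk \<sigma> X (models_upto A p0) (map_est X Mhat) \<le> ennreal (C * (\<sigma>\<^sup>2 * real ks))"
    unfolding max_risk_def dim_X by (intro SUP_least)
  also have "ennreal (C * (\<sigma>\<^sup>2 * real ks)) = ennreal (16 * C) * ennreal (\<sigma>\<^sup>2 * real (card Ms) / 16)"
    using C Ms(2) by (simp add: ennreal_mult[symmetric])
  also have "\<dots> \<le> ennreal (16 * C) * minimax_risk \<sigma> X (models_upto A p0)"
  proof (intro mult_left_mono minimax_risk_lower_bound[OF \<sigma> Ms(1)])
    show "Ms \<in> models_upto A p0"
      using Ms ks by (auto simp: models_upto_def models_of_size_def)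
  qed simp
  finally show ?thesis unfolding C_def .
qed

lemma (in sparse_design) num_models_le_exp:
  assumes K: "K \<ge> 0"
    and count: "\<And>k. k \<in> {1..<r} \<Longrightarrow> num_models A k > 0 \<Longrightarrow> ln (real (num_models A k)) \<le> K * real k"
    and k: "k \<le> r"
  shows "real (num_models A k) \<le> exp (K * real k)"
proof -
  consider "k = 0" | "k = r" | "k \<in> {1..<r}" using k by fastforce
  then show ?thesis
  proof cases
    case 3
    show ?thesis
    proof (cases "num_models A k > 0")
      case True
      then show ?thesis using count[OF 3 True] by (metis exp_le_cancel_iff exp_ln of_nat_0_less_iff)
    qed simp
  qed (use K in \<open>simp_all add: num_models_0 num_models_r\<close>)
qed

theorem corollary3:
  fixes p r :: "nat \<Rightarrow> nat" and X :: "nat \<Rightarrow> real mat" and A :: "nat \<Rightarrow> nat set set" and \<sigma> :: real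
  assumes sigma: "\<sigma> > 0"
    and design: "\<And>n. X n \<in> carrier_mat n (p n)"
    and rank: "\<And>n. r n = vec_space.rank n (X n)"
    and rank_lim: "filterlim r at_top sequentially"
    and indep: "\<And>n. every_cols_indep (r n) (X n)"
    and admissible: "\<And>n. admissible_class (p n) (r n) (A n)"
    and nearly_orthogonal: "\<exists>\<delta>>0. \<forall>n. r n \<ge> 1 \<longrightarrow> tau (X n) (r n) \<ge> \<delta>"
    and model_count: "\<exists>K. \<forall>n. \<forall>k\<in>{1..<r n}.
      num_models (A n) k > 0 \<longrightarrow> ln (real (num_models (A n) k)) \<le> K * real k"
  shows
    "(\<exists>C1>0. \<exists>C2>0. \<exists>R. \<forall>n. r n \<ge> R \<longrightarrow> (\<forall>p0\<in>{1..r n}.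
        minimax_risk \<sigma> (X n) (models_upto (A n) p0) \<le> ennreal (C2 * (\<sigma>\<^sup>2 * real p0)) \<and>
        (num_models (A n) p0 > 0 \<longrightarrow>
           ennreal (C1 * (\<sigma>\<^sup>2 * real p0)) \<le> minimax_risk \<sigma> (X n) (models_upto (A n) p0))))
     \<and>
     (\<forall>\<gamma>>0. \<forall>c>0. \<forall>\<pi> :: nat \<Rightarrow> nat pmf. \<forall>Mhat :: nat \<Rightarrow> real Matrix.vec \<Rightarrow> nat set.
        (\<forall>n. size_prior (r n) (A n) (\<pi> n)) \<longrightarrow>
        (\<forall>n. \<forall>k\<in>{1..r n}. num_models (A n) k > 0 \<longrightarrow>
            exp (- c * real k) \<le> pmf (\<pi> n) k \<and>
            pmf (\<pi> n) k \<le> real (num_models (A n) k) * exp (- (8 * (\<gamma> + 3/4)\<^sup>2) * real k)) \<longrightarrow>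
        (\<forall>n. is_map_model \<sigma> \<gamma> (X n) (A n) (\<pi> n) (Mhat n)) \<longrightarrow>
        (\<exists>C>0. \<exists>R. \<forall>n. r n \<ge> R \<longrightarrow> (\<forall>p0\<in>{1..r n}. (\<exists>k\<in>{1..p0}. num_models (A n) k > 0) \<longrightarrow>
            max_risk \<sigma> (X n) (models_upto (A n) p0) (map_est (X n) (Mhat n))
              \<le> ennreal C * minimax_risk \<sigma> (X n) (models_upto (A n) p0))))"
proof -
  obtain \<delta> where \<delta>: "\<delta> > 0" "\<And>n. r n \<ge> 1 \<Longrightarrow> tau (X n) (r n) \<ge> \<delta>"
    using nearly_orthogonal by blast
  obtain K0 where K0: "\<And>n k. k \<in> {1..<r n} \<Longrightarrow> num_models (A n) k > 0 \<Longrightarrow>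
      ln (real (num_models (A n) k)) \<le> K0 * real k"
    using model_count by blast
  define K where "K = max K0 0"
  have K: "K \<ge> 0" by (simp add: K_def)
  have count: "ln (real (num_models (A n) k)) \<le> K * real k"
    if "k \<in> {1..<r n}" "num_models (A n) k > 0" for n k
    using K0[OF that] mult_right_mono[of K0 K "real k"] by (simp add: K_def)
  have sd: "sparse_design (X n) n (p n) (r n) (A n)" if "r n \<ge> 1" for n
  proof
    show "tau (X n) (r n) > 0" using \<delta>(1) \<delta>(2)[OF that] by linarith
  qed (rule design admissible)+
  have size: "real (num_models (A n) k) \<le> exp (K * real k)" if "r n \<ge> 1" "k \<le> r n" for n k
    using sparse_design.num_models_le_exp[OF sd[OF that(1)] K count that(2)] .
  show ?thesis
  proof (intro conjI allI impI)
    show "\<exists>C1>0. \<exists>C2>0. \<exists>R. \<forall>n. r n \<ge> R \<longrightarrow> (\<forall>p0\<in>{1..r n}.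
        minimax_risk \<sigma> (X n) (models_upto (A n) p0) \<le> ennreal (C2 * (\<sigma>\<^sup>2 * real p0)) \<and>
        (num_models (A n) p0 > 0 \<longrightarrow>
           ennreal (C1 * (\<sigma>\<^sup>2 * real p0)) \<le> minimax_risk \<sigma> (X n) (models_upto (A n) p0)))"
    proof (rule exI[of _ "1 / 16"], rule conjI, simp, rule exI[of _ "16 * (K + 5)"], rule conjI,
        use K in simp, rule exI[of _ 1], intro allI impI ballI conjI)
      fix n p0 assume n: "1 \<le> r n" and p0: "p0 \<in> {1..r n}"
      interpret sparse_design "X n" n "p n" "r n" "A n" using n by (rule sd)
      show "minimax_risk \<sigma> (X n) (models_upto (A n) p0) \<le> ennreal (16 * (K + 5) * (\<sigma>\<^sup>2 * real p0))"
        using p0 by (intro minimax_risk_upper_bound[OF sigma K size[OF n]]) auto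
      assume "num_models (A n) p0 > 0"
      then have "models_of_size (A n) p0 \<noteq> {}" by (auto simp: num_models_def)
      then obtain M where M: "M \<in> A n" "card M = p0" by (auto simp: models_of_size_def)
      then have "M \<in> models_upto (A n) p0" by (auto simp: models_upto_def models_of_size_def)
      from minimax_risk_lower_bound[OF sigma M(1) this]
      show "ennreal (1 / 16 * (\<sigma>\<^sup>2 * real p0)) \<le> minimax_risk \<sigma> (X n) (models_upto (A n) p0)"
        using M(2) by simp
    qed
  next
    fix \<gamma> c :: real and \<pi> :: "nat \<Rightarrow> nat pmf" and Mhat :: "nat \<Rightarrow> real Matrix.vec \<Rightarrow> nat set"
    assume \<gamma>: "\<gamma> > 0" and c: "c > 0" and prior: "\<forall>n. size_prior (r n) (A n) (\<pi> n)"
      and bounds: "\<forall>n. \<forall>k\<in>{1..r n}. num_models (A n) k > 0 \<longrightarrow>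
            exp (- c * real k) \<le> pmf (\<pi> n) k \<and>
            pmf (\<pi> n) k \<le> real (num_models (A n) k) * exp (- (8 * (\<gamma> + 3/4)\<^sup>2) * real k)"
      and map: "\<forall>n. is_map_model \<sigma> \<gamma> (X n) (A n) (\<pi> n) (Mhat n)"
    show "\<exists>C>0. \<exists>R. \<forall>n. r n \<ge> R \<longrightarrow> (\<forall>p0\<in>{1..r n}. (\<exists>k\<in>{1..p0}. num_models (A n) k > 0) \<longrightarrow>
            max_risk \<sigma> (X n) (models_upto (A n) p0) (map_est (X n) (Mhat n))
              \<le> ennreal C * minimax_risk \<sigma> (X n) (models_upto (A n) p0))"
    proof (rule exI[of _ "16 * map_risk_factor \<gamma> c K"], rule conjI,
        use map_risk_factor_pos[OF \<gamma> c K] in simp, rule exI[of _ 1], intro allI impI ballI)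
      fix n p0 assume n: "1 \<le> r n" and ex: "\<exists>k\<in>{1..p0}. num_models (A n) k > 0"
      interpret sparse_design "X n" n "p n" "r n" "A n" using n by (rule sd)
      show "max_risk \<sigma> (X n) (models_upto (A n) p0) (map_est (X n) (Mhat n))
          \<le> ennreal (16 * map_risk_factor \<gamma> c K) * minimax_risk \<sigma> (X n) (models_upto (A n) p0)"
        using bounds
        by (intro map_estimator_rate_optimal[OF sigma \<gamma> c K size[OF n] prior[rule_format] _ map[rule_format] ex]) blast+
    qed
  qed
qed

end
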